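(* Let $n=2p+1$ with $p\ge 0$ an integer, let $R>0$, let $\vec s\in\mathbb{R}^n$ with $s=|\vec s|<R$. Then \[\frac{1}{n!\,\omega_n}\int_{\vec x\in S^{n-1}_R}e^{-|\vec x-\vec s|}\,\mathrm{d}\vec x=\frac{(-1)^pe^{-R}}{2^pp!}\sum_{i=0}^p\binom{p}{i}\chi_{p+i}(R)\tau_i(s).\]
   Context: $S^{n-1}_R$ is the sphere of radius $R$ centred at the origin with its surface measure, and $\omega_n$ is the volume of the unit $n$-ball. The reverse Bessel polynomials are defined by $\chi_0(R)=1$, $\chi_1(R)=R$, $\chi_{i+2}(R)=R^2\chi_i(R)+(2i+1)\chi_{i+1}(R)$. The functions $\tau_i$ are defined by $\tau_0=\cosh$ and $\tau_{i+1}(s)=-\frac1s\tau_i'(s)$ for $s\ne0$; each $\tau_i$ extends to an even real-analytic function on $\mathbb{R}$, and $\tau_i(0)$ denotes the value of this extension. *)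

theory Defs
  imports "HOL-Analysis.Analysis"
begin

text \<open>Surface measure on the sphere of radius R centred at 0 in the Euclidean space 'a,
  defined through the cone construction: for A a subset of the sphere, its surface measure is
  n R^(n-1) times the Lebesgue measure of the set of points x of the open unit ball with
  (R / |x|) x in A (n = DIM('a)). This is the standard (n-1)-dimensional surface measure.\<close>
definition sphere_measure :: "real \<Rightarrow> 'a::euclidean_space measure" where
  "sphere_measure R =
     scale_measure (ennreal (real DIM('a) * R ^ (DIM('a) - 1)))
       (distr (restrict_space lborel (ball 0 1)) borel (\<lambda>x. (R / norm x) *\<^sub>R x))"

definition unit_ball_volume :: "'a::euclidean_space itself \<Rightarrow> real" where
  "unit_ball_volume _ = measure lborel (ball (0::'a) 1)"

text \<open>Reverse Bessel polynomials evaluated at R.\<close>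
fun chi :: "nat \<Rightarrow> real \<Rightarrow> real" where
  "chi 0 R = 1"
| "chi (Suc 0) R = R"
| "chi (Suc (Suc i)) R = R^2 * chi i R + real (2*i+1) * chi (Suc i) R"

text \<open>tau_0 = cosh, tau_(i+1)(s) = -tau_i'(s)/s for s \<noteq> 0, and at 0 the value of the
  continuous (even real-analytic) extension, i.e. the limit at 0.\<close>
fun tau :: "nat \<Rightarrow> real \<Rightarrow> real" where
  "tau 0 = cosh"
| "tau (Suc i) = (\<lambda>s. if s \<noteq> 0 then - deriv (tau i) s / s
                     else Lim (at 0) (\<lambda>t. - deriv (tau i) t / t))"

end

theory Submission
  imports Defs
begin

text \<open>
  Write \<open>s = t e\<close> with a unit vector \<open>e\<close>, let \<open>u\<close> be the coordinate along \<open>e\<close> on the unit sphere, and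
  let \<open>k\<^sub>i(r)\<close> be \<open>e\<^sup>-\<^sup>r\<close> with \<open>- (1 / r) d/dr\<close> applied \<open>i\<close> times. The integrals \<open>\<phi>\<^sub>i(t)\<close> of
  \<open>k\<^sub>i((R\<^sup>2 + t\<^sup>2 - 2 R t u)\<^sup>1\<^sup>/\<^sup>2)\<close> over the sphere satisfy
  \<open>\<phi>\<^sub>i'' + (2 p / t) \<phi>\<^sub>i' = \<phi>\<^sub>i - 2 (p - i) \<phi>\<^sub>i\<^sub>+\<^sub>1\<close>: the function \<open>k\<^sub>p\<close> is, up to a constant, the fundamental
  solution of \<open>1 - \<Delta>\<close> in dimension \<open>2 p + 1\<close>, and \<open>1 - \<Delta>\<close> maps \<open>k\<^sub>i\<close> to a multiple of \<open>k\<^sub>i\<^sub>+\<^sub>1\<close>. The functions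
  \<open>\<tau>\<^sub>i\<close> satisfy the same equations, so downward induction from \<open>i = p\<close> and uniqueness for the radial
  equation express each \<open>\<phi>\<^sub>i\<close> through \<open>\<tau>\<^sub>i, \<dots>, \<tau>\<^sub>p\<close>; the coefficients come from the values
  \<open>\<phi>\<^sub>i(0)\<close>, which involve only \<open>\<chi>\<^sub>i(R)\<close>. The theorem is the case \<open>i = 0\<close>. The only information
  needed about the sphere is that \<open>u\<close> has mean 0 and an integration by parts formula for \<open>u\<close>.
\<close>

section \<open>Recurrences for the kernels and for \<open>\<tau>\<close>\<close>

text \<open>As a function of \<open>y = r\<^sup>2\<close>, this is \<open>e\<^sup>-\<^sup>r\<close> with \<open>- (1 / r) d/dr\<close> applied \<open>i\<close> times, so that it
  satisfies the same differential and recurrence relations as \<open>tau i\<close>.\<close>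

definition kap :: "nat \<Rightarrow> real \<Rightarrow> real" where
  "kap i y = chi i (sqrt y) * exp (- sqrt y) / y ^ i"

lemma kap_rec:
  assumes "y > 0"
  shows "y * kap (Suc (Suc i)) y = kap i y + real (2 * i + 1) * kap (Suc i) y"
  using assms by (simp add: kap_def field_simps)

text \<open>The factor 1/2 comes from d/dy = (1 / (2 r)) d/dr for y = r^2. There are two base cases
  because \<open>chi\<close> obeys a three-term recurrence; the induction step differentiates
  \<open>kap_rec\<close> solved for \<open>kap (Suc (Suc i))\<close>.\<close>

lemma kap_deriv:
  assumes "y > 0"
  shows "(kap i has_real_derivative - kap (Suc i) y / 2) (at y)"
  using assms
proof (induction i arbitrary: y rule: induct_nat_012)
  case 0
  then have "((\<lambda>y. exp (- sqrt y)) has_real_derivative - kap (Suc 0) y / 2) (at y)"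
    by (auto intro!: derivative_eq_intros simp: kap_def field_simps real_sqrt_mult_self)
  then show ?case by (simp add: kap_def[abs_def])
next
  case 1
  have "((\<lambda>y. sqrt y * exp (- sqrt y) / y) has_real_derivative - kap (Suc (Suc 0)) y / 2) (at y)"
  proof -
    define r where "r = sqrt y"
    have r: "r > 0" "y = r ^ 2" using 1 by (simp_all add: r_def)
    have "((\<lambda>y. sqrt y * exp (- sqrt y) / y) has_real_derivative
        ((inverse r / 2 * exp (- r) + r * (exp (- r) * - (inverse r / 2))) * y - r * exp (- r)) / (y * y)) (at y)"
      using 1 by (auto intro!: derivative_eq_intros simp: r_def)
    also have "((inverse r / 2 * exp (- r) + r * (exp (- r) * - (inverse r / 2))) * y - r * exp (- r)) / (y * y)
        = - kap (Suc (Suc 0)) y / 2"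
      using r by (simp add: kap_def field_simps power2_eq_square real_sqrt_mult)
    finally show ?thesis .
  qed
  then show ?case by (simp add: kap_def[abs_def])
next
  case (ge2 i)
  have "((\<lambda>y. (kap i y + real (2 * i + 1) * kap (Suc i) y) / y) has_real_derivative
      ((- kap (Suc i) y / 2 + real (2 * i + 1) * (- kap (Suc (Suc i)) y / 2)) * y
        - (kap i y + real (2 * i + 1) * kap (Suc i) y)) / (y * y)) (at y)"
    using ge2 by (auto intro!: derivative_eq_intros)
  also have "((- kap (Suc i) y / 2 + real (2 * i + 1) * (- kap (Suc (Suc i)) y / 2)) * y
        - (kap i y + real (2 * i + 1) * kap (Suc i) y)) / (y * y) = - kap (Suc (Suc (Suc i))) y / 2"
  proof -
    have "y * kap (Suc (Suc (Suc i))) y = kap (Suc i) y + real (2 * i + 3) * kap (Suc (Suc i)) y"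
      using kap_rec[OF ge2.prems, of "Suc i"] by (simp add: algebra_simps)
    then have "(- kap (Suc i) y / 2 + real (2 * i + 1) * (- kap (Suc (Suc i)) y / 2)) * y
        - y * kap (Suc (Suc i)) y = - (y * (y * kap (Suc (Suc (Suc i))) y)) / 2"
      by (simp add: algebra_simps)
    moreover have "kap i y + real (2 * i + 1) * kap (Suc i) y = y * kap (Suc (Suc i)) y"
      using kap_rec[OF ge2.prems, of i] by simp
    ultimately show ?thesis using ge2.prems by (simp add: field_simps)
  qed
  finally show ?case
  proof (rule DERIV_cong_ev[THEN iffD1, rotated 3])
    show "\<forall>\<^sub>F x in nhds y. (kap i x + real (2 * i + 1) * kap (Suc i) x) / x = kap (Suc (Suc i)) x"
      using eventually_nhds_in_open[of "{0<..}" y] ge2.prems kap_rec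
      by (auto elim!: eventually_mono simp: field_simps)
  qed auto
qed

lemma continuous_on_kap: "continuous_on {0<..} (kap i)"
  by (rule continuous_at_imp_continuous_on) (auto intro: DERIV_isCont kap_deriv)



text \<open>For an everywhere convergent power series F, the operator -(1/s) d/ds sends F(s^2) to -2
  F'(s^2), which is of the same kind. Its continuity at 0 evaluates the \<open>Lim\<close> in the
  definition of \<open>tau\<close>.\<close>

lemma tau_power_series:
  fixes f :: "nat \<Rightarrow> real"
  assumes s: "\<And>x. summable (\<lambda>k. f k * x ^ k)" and t: "tau i = (\<lambda>s. \<Sum>k. f k * (s\<^sup>2) ^ k)"
  shows "tau (Suc i) = (\<lambda>s. \<Sum>k. (- 2 * diffs f k) * (s\<^sup>2) ^ k)"
    and "\<And>x. summable (\<lambda>k. (- 2 * diffs f k) * x ^ k)"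
    and "(tau i has_real_derivative - s * tau (Suc i) s) (at s)"
proof -
  have sd: "summable (\<lambda>k. diffs f k * x ^ k)" for x
    using termdiff_converges_all[OF s] by simp
  show s': "summable (\<lambda>k. (- 2 * diffs f k) * x ^ k)" for x
    using summable_mult[OF sd, of "-2" x] by (simp add: mult.assoc)
  define g where "g = (\<lambda>s::real. \<Sum>k. (- 2 * diffs f k) * (s\<^sup>2) ^ k)"
  have g: "g x = - 2 * (\<Sum>k. diffs f k * (x\<^sup>2) ^ k)" for x
    using suminf_mult[OF sd, of "-2" "x\<^sup>2"] by (simp add: g_def mult.assoc)
  have d: "(tau i has_real_derivative - x * g x) (at x)" for x
  proof -
    have "((\<lambda>y. \<Sum>k. f k * y ^ k) has_real_derivative (\<Sum>k. diffs f k * (x\<^sup>2) ^ k)) (at (x\<^sup>2))"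
      by (rule termdiffs_strong_converges_everywhere) (rule s)
    then have "((\<lambda>y. \<Sum>k. f k * (y\<^sup>2) ^ k) has_real_derivative (\<Sum>k. diffs f k * (x\<^sup>2) ^ k) * (2 * x)) (at x)"
      by (rule DERIV_chain2) (auto intro!: derivative_eq_intros)
    then show ?thesis by (simp add: t g mult_ac)
  qed
  have "isCont g x" for x
    unfolding g_def
    by (rule isCont_o2[where f="\<lambda>x. x\<^sup>2" and g="\<lambda>x. \<Sum>k. (- 2 * diffs f k) * x ^ k"])
       (intro continuous_intros, rule DERIV_isCont[OF termdiffs_strong_converges_everywhere[OF s']])
  then have lim: "(g \<longlongrightarrow> g 0) (at 0)" by (simp add: isCont_def)
  have dd: "- deriv (tau i) x / x = g x" if "x \<noteq> 0" for x
    using DERIV_imp_deriv[OF d, of x] that by simp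
  have "((\<lambda>x. - deriv (tau i) x / x) \<longlongrightarrow> g 0) (at 0)"
    using lim by (rule Lim_transform_eventually) (auto simp: eventually_at_filter dd[symmetric] intro!: always_eventually)
  then have "Lim (at 0) (\<lambda>x. - deriv (tau i) x / x) = g 0"
    by (intro tendsto_Lim) auto
  then show *: "tau (Suc i) = (\<lambda>s. \<Sum>k. (- 2 * diffs f k) * (s\<^sup>2) ^ k)"
    using dd by (auto simp: fun_eq_iff g_def)
  show "(tau i has_real_derivative - s * tau (Suc i) s) (at s)"
    using d[of s] * by (simp add: g_def)
qed

declare tau.simps(2) [simp del]

lemma tau_ex_power_series:
  "\<exists>f. (\<forall>x::real. summable (\<lambda>k. f k * x ^ k)) \<and> tau i = (\<lambda>s. \<Sum>k. f k * (s\<^sup>2) ^ k)"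
proof (induction i)
  case 0
  have c: "(\<lambda>k. s ^ (2 * k) / fact (2 * k)) sums cosh s" for s :: real
  proof -
    have "(\<lambda>k. if even (2 * k) then s ^ (2 * k) /\<^sub>R fact (2 * k) else 0) sums cosh s"
      using cosh_converges[of s]
      by (subst sums_mono_reindex) (auto simp: strict_mono_def elim!: evenE)
    then show ?thesis by (simp add: divide_inverse mult.commute)
  qed
  \<comment> \<open>Since \<open>fact (2 * n)\<close> is at least \<open>fact n\<close>, the
    exponential series dominates.\<close>
  have sm: "summable (\<lambda>k. (1 / fact (2 * k)) * x ^ k)" for x :: real
  proof (rule summable_comparison_test)
    show "\<exists>N. \<forall>n\<ge>N. norm ((1 / fact (2 * n)) * x ^ n) \<le> norm (inverse (fact n) *\<^sub>R x ^ n)"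
      by (auto simp: abs_mult divide_inverse intro!: mult_right_mono le_imp_inverse_le fact_mono)
    show "summable (\<lambda>n. norm (inverse (fact n) *\<^sub>R x ^ n))"
      by (rule summable_norm_exp[unfolded])
  qed
  have "tau 0 = (\<lambda>s. \<Sum>k. (1 / fact (2 * k)) * (s\<^sup>2) ^ k)"
    using sums_unique[OF c] by (auto simp: fun_eq_iff divide_inverse mult.commute simp flip: power_mult)
  with sm show ?case by (intro exI[of _ "\<lambda>k. 1 / fact (2 * k)"] conjI allI)
next
  case (Suc i)
  then obtain f where "\<And>x::real. summable (\<lambda>k. f k * x ^ k)" "tau i = (\<lambda>s. \<Sum>k. f k * (s\<^sup>2) ^ k)"
    by blast
  from tau_power_series(1,2)[OF this] show ?case
    by (intro exI[of _ "\<lambda>k. - 2 * diffs f k"] conjI allI)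
qed

lemma tau_deriv: "(tau i has_real_derivative - s * tau (Suc i) s) (at s)"
  using tau_ex_power_series[of i] tau_power_series(3) by metis

lemma isCont_tau: "isCont (tau i) s"
  using tau_deriv DERIV_isCont by blast

text \<open>The base case differentiates -s \<open>tau 1 s\<close> = sinh s. Differentiating the
  identity for i gives s times the identity for i + 1, hence that identity for nonzero s; continuity
  adds s = 0.\<close>

lemma tau_rec: "s\<^sup>2 * tau (Suc (Suc i)) s = tau i s + real (2 * i + 1) * tau (Suc i) s"
proof (induction i arbitrary: s)
  case 0
  have "(tau 0 has_real_derivative sinh s) (at s)" for s
    by (auto intro!: derivative_eq_intros)
  then have "- s * tau (Suc 0) s = sinh s" for s
    using tau_deriv[of 0 s] DERIV_unique by blast
  then have e: "(\<lambda>s. - s * tau (Suc 0) s) = sinh" by blast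
  have "((\<lambda>s. - s * tau (Suc 0) s) has_real_derivative - tau (Suc 0) s + s * s * tau (Suc (Suc 0)) s) (at s)"
    by (rule derivative_eq_intros tau_deriv refl)+ simp
  then have "- tau (Suc 0) s + s * s * tau (Suc (Suc 0)) s = cosh s"
    unfolding e using DERIV_unique has_field_derivative_sinh[OF DERIV_ident, of s UNIV] by fastforce
  then show ?case by (simp add: power2_eq_square)
next
  case (Suc i)
  define h where "h = (\<lambda>s. s\<^sup>2 * tau (Suc (Suc (Suc i))) s - (tau (Suc i) s + real (2 * Suc i + 1) * tau (Suc (Suc i)) s))"
  have h0: "h s = 0" if "s \<noteq> 0" for s
  proof -
    have "((\<lambda>s. s\<^sup>2 * tau (Suc (Suc i)) s) has_real_derivative
        2 * s * tau (Suc (Suc i)) s + s\<^sup>2 * (- s * tau (Suc (Suc (Suc i))) s)) (at s)"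
      by (rule derivative_eq_intros tau_deriv refl)+ simp
    moreover have "((\<lambda>s. tau i s + real (2 * i + 1) * tau (Suc i) s) has_real_derivative
        - s * tau (Suc i) s + real (2 * i + 1) * (- s * tau (Suc (Suc i)) s)) (at s)"
      by (rule derivative_eq_intros tau_deriv refl)+ simp
    ultimately have "2 * s * tau (Suc (Suc i)) s + s\<^sup>2 * (- s * tau (Suc (Suc (Suc i))) s)
        = - s * tau (Suc i) s + real (2 * i + 1) * (- s * tau (Suc (Suc i)) s)"
      unfolding Suc using DERIV_unique by blast
    then have "s * h s = 0" by (simp add: h_def algebra_simps)
    then show ?thesis using that by simp
  qed
  have "isCont h 0" unfolding h_def by (intro continuous_intros isCont_tau)
  moreover have "(h \<longlongrightarrow> 0) (at 0)"
    by (rule Lim_transform_eventually[OF tendsto_const]) (auto simp: eventually_at_filter h0)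
  ultimately have "h 0 = 0" unfolding isCont_def using LIM_unique by blast
  with h0 have "h s = 0" by metis
  then show ?case by (simp add: h_def)
qed

section \<open>Values at 0 and their binomial sums\<close>

lemma tau_0_Suc: "tau i 0 = - real (2 * i + 1) * tau (Suc i) 0"
  using tau_rec[of 0 i] by (simp add: algebra_simps)

text \<open>Iterating \<open>tau_0_Suc\<close> gives \<open>tau p 0\<close> = (-1)^p / (1 * 3 * ...
  * (2p - 1)), and (2p)! is 2^p p! times that product of odd numbers.\<close>

lemma tau_0_fact: "tau p 0 * fact (2 * p) = (- 1) ^ p * 2 ^ p * fact p"
proof (induction p)
  case (Suc p)
  have "tau (Suc p) 0 * fact (2 * Suc p) = (2 * real p + 2) * fact (2 * p) * (real (2 * p + 1) * tau (Suc p) 0)"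
    by (simp add: algebra_simps)
  also have "\<dots> = - (2 * real p + 2) * (tau p 0 * fact (2 * p))"
    by (simp add: tau_0_Suc[of p] algebra_simps)
  finally show ?case unfolding Suc by (simp add: algebra_simps)
qed simp

text \<open>For \<open>a = p + j\<close> and \<open>b = p\<close> these sums compute the value at 0 of the combination of
  \<open>tau p, \<dots>, tau (p - j)\<close> that is compared with the integral.\<close>

definition chitau :: "real \<Rightarrow> nat \<Rightarrow> nat \<Rightarrow> nat \<Rightarrow> real" where
  "chitau R j a b = (\<Sum>m\<le>j. real (j choose m) * chi (a - m) R * tau (b - m) 0)"

text \<open>Pascal's rule, split into two sums and reindexed.\<close>

lemma binomial_sum_Suc:
  fixes f :: "nat \<Rightarrow> real"
  shows "(\<Sum>m\<le>Suc j. real (Suc j choose m) * f m) = (\<Sum>m\<le>j. real (j choose m) * (f m + f (Suc m)))"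
proof -
  have "(\<Sum>m\<le>Suc j. real (Suc j choose m) * f m) = f 0 + (\<Sum>m\<le>j. real (Suc j choose Suc m) * f (Suc m))"
    by (subst sum.atMost_Suc_shift) simp
  also have "\<dots> = (f 0 + (\<Sum>m\<le>j. real (j choose Suc m) * f (Suc m))) + (\<Sum>m\<le>j. real (j choose m) * f (Suc m))"
    by (simp add: sum.distrib algebra_simps)
  also have "f 0 + (\<Sum>m\<le>j. real (j choose Suc m) * f (Suc m)) = (\<Sum>m\<le>Suc j. real (j choose m) * f m)"
    by (subst sum.atMost_Suc_shift) simp
  also have "\<dots> = (\<Sum>m\<le>j. real (j choose m) * f m)" by simp
  finally show ?thesis by (simp add: sum.distrib algebra_simps)
qed

lemma chitau_Suc: "chitau R (Suc j) a b = chitau R j a b + chitau R j (a - 1) (b - 1)"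
  unfolding chitau_def mult.assoc binomial_sum_Suc
  by (simp add: sum.distrib algebra_simps)

text \<open>Pascal's rule pairs neighbouring terms. With k = p - m - 1, the recurrence of
  \<open>chi\<close> contributes the factor 2(k + j) + 1 and \<open>tau_0_Suc\<close> contributes
  -(2k + 1); their sum 2j is independent of m and leaves the sum.\<close>

lemma chitau_Suc_diag:
  assumes "Suc j \<le> p"
  shows "chitau R (Suc j) (Suc (p + j)) p = R\<^sup>2 * chitau R j (p + j - 1) p + 2 * real j * chitau R j (p + j) p"
proof -
  have "chitau R (Suc j) (Suc (p + j)) p
      = (\<Sum>m\<le>j. real (j choose m) * (chi (Suc (p + j) - m) R * tau (p - m) 0 + chi (p + j - m) R * tau (p - Suc m) 0))"
    unfolding chitau_def mult.assoc binomial_sum_Suc by simp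
  also have "\<dots> = (\<Sum>m\<le>j. real (j choose m) * (R\<^sup>2 * (chi (p + j - 1 - m) R * tau (p - m) 0)
      + 2 * real j * (chi (p + j - m) R * tau (p - m) 0)))"
  proof (intro sum.cong refl arg_cong2[where f="(*)"])
    fix m assume "m \<in> {..j}"
    then obtain k where k: "p = Suc (m + k)" using assms by (metis Suc_le_D Suc_le_mono add_Suc atMost_iff le_Suc_ex le_trans)
    have "p + j - 1 - m = k + j" "p + j - m = Suc (k + j)" "Suc (p + j) - m = Suc (Suc (k + j))" "p - m = Suc k" "p - Suc m = k"
      using k by auto
    then show "chi (Suc (p + j) - m) R * tau (p - m) 0 + chi (p + j - m) R * tau (p - Suc m) 0
        = R\<^sup>2 * (chi (p + j - 1 - m) R * tau (p - m) 0) + 2 * real j * (chi (p + j - m) R * tau (p - m) 0)"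
      by (simp add: tau_0_Suc[of k] algebra_simps)
  qed
  finally show ?thesis
    by (simp add: chitau_def sum_distrib_left sum.distrib algebra_simps)
qed

text \<open>\<open>chitau_Suc_diag\<close> leaves one sum off the diagonal, which
  \<open>chitau_Suc\<close> splits into diagonal sums for p and p - 1. The induction hypotheses then
  leave exactly the recurrence of \<open>chi\<close> at index p - j.\<close>

lemma chitau_diag:
  assumes "j \<le> p"
  shows "chitau R j (p + j) p = tau p 0 * R ^ (2 * j) * chi (p - j) R"
  using assms
proof (induction j arbitrary: p rule: induct_nat_012)
  case 0 then show ?case by (simp add: chitau_def)
next
  case 1
  then show ?case
    using chitau_Suc_diag[of 0 p R] by (simp add: chitau_def)
next
  case (ge2 j)
  then obtain k where k: "p = Suc (Suc (j + k))" by (metis add_Suc le_Suc_ex)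
  have "chitau R (Suc (Suc j)) (p + Suc (Suc j)) p
      = R\<^sup>2 * chitau R (Suc j) (p + j) p + 2 * real (Suc j) * chitau R (Suc j) (p + Suc j) p"
    using chitau_Suc_diag[of "Suc j" p R] ge2.prems by simp
  also have "chitau R (Suc j) (p + j) p = chitau R j (p + j) p + chitau R j (p - 1 + j) (p - 1)"
    using k by (simp add: chitau_Suc)
  also have "chitau R j (p + j) p = tau p 0 * R ^ (2 * j) * chi (p - j) R"
    using ge2 by simp
  also have "chitau R j (p - 1 + j) (p - 1) = tau (p - 1) 0 * R ^ (2 * j) * chi (p - 1 - j) R"
    using ge2.prems by (intro ge2.IH(1)) simp
  also have "chitau R (Suc j) (p + Suc j) p = tau p 0 * R ^ (2 * Suc j) * chi (p - Suc j) R"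
    using ge2.prems by (intro ge2.IH(2)) simp
  also have "p - 1 = Suc (j + k)" using k by simp
  also have "tau (Suc (j + k)) 0 = - real (2 * Suc (j + k) + 1) * tau p 0"
    using tau_0_Suc[of "Suc (j + k)"] k by simp
  finally have *: "chitau R (Suc (Suc j)) (p + Suc (Suc j)) p =
      R\<^sup>2 * (tau p 0 * R ^ (2 * j) * chi (p - j) R +
        - real (2 * Suc (j + k) + 1) * tau p 0 * R ^ (2 * j) * chi (Suc (j + k) - j) R) +
      2 * real (Suc j) * (tau p 0 * R ^ (2 * Suc j) * chi (p - Suc j) R)" .
  have "p - j = Suc (Suc k)" "p - Suc j = Suc k" "Suc (j + k) - j = Suc k" "p - Suc (Suc j) = k"
    using k by auto
  with * show ?case
    using k by (simp add: algebra_simps power_add power2_eq_square)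
qed

section \<open>Radial differential equations\<close>

lemma has_real_derivative_integral:
  fixes F :: "'b \<Rightarrow> real \<Rightarrow> real"
  assumes "\<delta> > 0"
    and int: "\<And>t. \<bar>t - t0\<bar> < \<delta> \<Longrightarrow> integrable M (\<lambda>x. F x t)"
    and F': "F' \<in> borel_measurable M"
    and w: "integrable M w"
    and lip: "\<And>x t. \<bar>t - t0\<bar> < \<delta> \<Longrightarrow> \<bar>F x t - F x t0\<bar> \<le> w x * \<bar>t - t0\<bar>"
    and AE: "AE x in M. (F x has_real_derivative F' x) (at t0)"
  shows "((\<lambda>t. \<integral>x. F x t \<partial>M) has_real_derivative (\<integral>x. F' x \<partial>M)) (at t0)"
proof -
  have "((\<lambda>t. ((\<integral>x. F x t \<partial>M) - (\<integral>x. F x t0 \<partial>M)) / (t - t0)) \<longlongrightarrow> (\<integral>x. F' x \<partial>M)) (at t0 within ball t0 \<delta>)"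
    unfolding tendsto_at_iff_sequentially
  proof (intro allI impI)
    fix X assume X: "\<forall>i. X i \<in> ball t0 \<delta> - {t0}" "X \<longlonglongrightarrow> t0"
    have X': "\<bar>X i - t0\<bar> < \<delta>" "X i \<noteq> t0" for i
      using X(1) by (auto simp: dist_real_def abs_minus_commute)
    have int0: "integrable M (\<lambda>x. F x t0)" using int[of t0] \<open>\<delta> > 0\<close> by simp
    have "(\<lambda>i. \<integral>x. (F x (X i) - F x t0) / (X i - t0) \<partial>M) \<longlonglongrightarrow> (\<integral>x. F' x \<partial>M)"
    proof (rule integral_dominated_convergence[where w=w])
      show "F' \<in> borel_measurable M" "integrable M w" by fact+
      show "(\<lambda>x. (F x (X i) - F x t0) / (X i - t0)) \<in> borel_measurable M" for i
        using int[OF X'(1), of i] int0 by (auto intro!: borel_measurable_divide borel_measurable_diff)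
      show "AE x in M. norm ((F x (X i) - F x t0) / (X i - t0)) \<le> w x" for i
        using lip[OF X'(1)] X'(2)[of i] by (auto simp: abs_divide pos_divide_le_eq)
      show "AE x in M. (\<lambda>i. (F x (X i) - F x t0) / (X i - t0)) \<longlonglongrightarrow> F' x"
        using AE
      proof eventually_elim
        case (elim x)
        then have "((\<lambda>t. (F x t - F x t0) / (t - t0)) \<longlongrightarrow> F' x) (at t0)"
          by (simp add: has_field_derivative_iff)
        then show ?case
          using X X' unfolding tendsto_at_iff_sequentially by (auto simp: o_def)
      qed
    qed
    also have "(\<lambda>i. \<integral>x. (F x (X i) - F x t0) / (X i - t0) \<partial>M)
        = (\<lambda>t. ((\<integral>x. F x t \<partial>M) - (\<integral>x. F x t0 \<partial>M)) / (t - t0)) \<circ> X"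
      using int[OF X'(1)] int0 by (auto simp: fun_eq_iff)
    finally show "((\<lambda>t. ((\<integral>x. F x t \<partial>M) - (\<integral>x. F x t0 \<partial>M)) / (t - t0)) \<circ> X) \<longlonglongrightarrow> (\<integral>x. F' x \<partial>M)" .
  qed
  then show ?thesis
    using \<open>\<delta> > 0\<close> by (simp add: has_field_derivative_iff at_within_open[of t0 "ball t0 \<delta>"])
qed

text \<open>The energy \<open>w'\<^sup>2 - w\<^sup>2\<close> is nonincreasing, hence \<open>\<bar>w'\<bar> \<le> \<bar>w\<bar>\<close>, and so \<open>w\<^sup>2 e\<^sup>-\<^sup>2\<^sup>t\<close> is nonincreasing
  as well.\<close>

lemma radial_ode_unique:
  fixes w w' w'' :: "real \<Rightarrow> real"
  assumes w: "\<And>t. 0 \<le> t \<Longrightarrow> t < a \<Longrightarrow> (w has_real_derivative w' t) (at t)"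
    and w': "\<And>t. 0 \<le> t \<Longrightarrow> t < a \<Longrightarrow> (w' has_real_derivative w'' t) (at t)"
    and ode: "\<And>t. 0 < t \<Longrightarrow> t < a \<Longrightarrow> t * w'' t + c * w' t = t * w t"
    and "c \<ge> 0" "w 0 = 0" "w' 0 = 0"
    and t: "0 \<le> t" "t < a"
  shows "w t = 0"
proof -
  have cw: "isCont w t" "isCont w' t" if "0 \<le> t" "t < a" for t
    using w[OF that] w'[OF that] DERIV_isCont by blast+
  have E: "(w' t)\<^sup>2 \<le> (w t)\<^sup>2" if t: "0 \<le> t" "t < a" for t
  proof -
    have "(w' 0)\<^sup>2 - (w 0)\<^sup>2 \<ge> (w' t)\<^sup>2 - (w t)\<^sup>2"
    \<comment> \<open>Derivatives are needed only in the interior, where the equation is available;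
      there the damping term gives the energy the derivative -2 c w'^2 / x.\<close>
    proof (rule DERIV_nonpos_imp_decreasing_open[OF t(1)])
      fix x assume x: "0 < x" "x < t"
      have "((\<lambda>t. (w' t)\<^sup>2 - (w t)\<^sup>2) has_real_derivative 2 * w' x * w'' x - 2 * w x * w' x) (at x)"
        using x t by (auto intro!: derivative_eq_intros w w')
      moreover have "2 * w' x * w'' x - 2 * w x * w' x = 2 * w' x * (x * w'' x - x * w x) / x"
        using x by (simp add: field_simps)
      moreover have "x * w'' x - x * w x = - c * w' x" using ode[of x] x t by simp
      then have "2 * w' x * (x * w'' x - x * w x) / x = - (2 * c * (w' x)\<^sup>2 / x)"
        by (simp add: power2_eq_square)
      ultimately have "((\<lambda>t. (w' t)\<^sup>2 - (w t)\<^sup>2) has_real_derivative - (2 * c * (w' x)\<^sup>2 / x)) (at x)"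
        by simp
      moreover have "- (2 * c * (w' x)\<^sup>2 / x) \<le> 0" using x \<open>c \<ge> 0\<close> by simp
      ultimately show "\<exists>y. ((\<lambda>t. (w' t)\<^sup>2 - (w t)\<^sup>2) has_real_derivative y) (at x) \<and> y \<le> 0"
        by blast
    next
      show "continuous_on {0..t} (\<lambda>t. (w' t)\<^sup>2 - (w t)\<^sup>2)"
        using t cw by (auto intro!: continuous_at_imp_continuous_on continuous_intros)
    qed
    then show ?thesis using assms by simp
  qed
  have "(w 0)\<^sup>2 * exp (- (2 * 0)) \<ge> (w t)\<^sup>2 * exp (- (2 * t))"
  proof (rule DERIV_nonpos_imp_decreasing_open[OF t(1)])
    fix x assume x: "0 < x" "x < t"
    have "((\<lambda>t. (w t)\<^sup>2 * exp (- (2 * t))) has_real_derivative 2 * (w x * w' x - (w x)\<^sup>2) * exp (- (2 * x))) (at x)"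
      using x t by (auto intro!: derivative_eq_intros w simp: algebra_simps power2_eq_square)
    moreover have "2 * (w x * w' x - (w x)\<^sup>2) * exp (- (2 * x)) \<le> 0"
    proof -
      have "\<bar>w' x\<bar> \<le> \<bar>w x\<bar>" using E[of x] x t by (simp add: abs_le_square_iff)
      then have "\<bar>w x\<bar> * \<bar>w' x\<bar> \<le> \<bar>w x\<bar> * \<bar>w x\<bar>" by (intro mult_left_mono) auto
      then have "w x * w' x \<le> w x * w x" using abs_ge_self[of "w x * w' x"] by (simp add: abs_mult)
      then show ?thesis by (simp add: power2_eq_square mult_le_0_iff)
    qed
    ultimately show "\<exists>y. ((\<lambda>t. (w t)\<^sup>2 * exp (- (2 * t))) has_real_derivative y) (at x) \<and> y \<le> 0"
      by blast
  next
    show "continuous_on {0..t} (\<lambda>t. (w t)\<^sup>2 * exp (- (2 * t)))"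
      using t cw by (auto intro!: continuous_at_imp_continuous_on continuous_intros)
  qed
  then have "(w t)\<^sup>2 * exp (- (2 * t)) \<le> 0" using \<open>w 0 = 0\<close> by simp
  then show ?thesis by (simp add: mult_le_0_iff)
qed

text \<open>The distribution of a linear coordinate \<open>u\<close> on the unit sphere of the space of dimension
  \<open>2 p + 1\<close>, described through integration by parts. For \<open>p \<ge> 1\<close> the identity says that \<open>u\<close> has a density
  proportional to \<open>(1 - u\<^sup>2) ^ (p - 1)\<close>, and \<open>integral_u\<close> follows from it; for \<open>p = 0\<close> it says that \<open>u\<close> is
  concentrated on \<open>{- 1, 1}\<close>, and \<open>integral_u\<close> is needed.\<close>

locale sphere_coordinate = finite_measure M for M :: "'b measure" +
  fixes u :: "'b \<Rightarrow> real" and p :: nat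
  assumes u_measurable [measurable]: "u \<in> borel_measurable M"
    and u_bound: "\<And>x. u x \<in> {- 1..1}"
    and integral_u: "(\<integral>x. u x \<partial>M) = 0"
    and by_parts: "\<And>G G'. (\<And>y. y \<in> {- 1..1} \<Longrightarrow> (G has_real_derivative G' y) (at y)) \<Longrightarrow>
      continuous_on {- 1..1} G' \<Longrightarrow>
      (\<integral>x. (1 - (u x)\<^sup>2) * G' (u x) \<partial>M) = 2 * real p * (\<integral>x. u x * G (u x) \<partial>M)"
begin

lemma measurable_comp_u:
  assumes "continuous_on {- 1..1} g"
  shows "(\<lambda>x. g (u x)) \<in> borel_measurable M"
proof -
  \<comment> \<open>Clamping the argument to [-1, 1] extends g continuously to the line without
    changing g(u).\<close>
  have "continuous_on UNIV (\<lambda>y::real. g (max (- 1) (min 1 y)))"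
    by (rule continuous_on_compose2[OF assms]) (auto intro!: continuous_intros)
  then have "(\<lambda>y::real. g (max (- 1) (min 1 y))) \<in> borel_measurable borel"
    by (rule borel_measurable_continuous_onI)
  from measurable_compose[OF u_measurable this] show ?thesis
    using u_bound by (simp add: min.absorb2 max.absorb2)
qed

lemma integrable_comp_u:
  fixes g :: "real \<Rightarrow> real"
  assumes "continuous_on {- 1..1} g"
  shows "integrable M (\<lambda>x. g (u x))"
proof -
  have "bounded (g ` {- 1..1})"
    using assms by (intro compact_imp_bounded compact_continuous_image) auto
  then obtain B where "\<And>y. y \<in> {- 1..1} \<Longrightarrow> norm (g y) \<le> B"
    unfolding bounded_iff by blast
  then show ?thesis
    using u_bound by (intro integrable_const_bound[where B=B] measurable_comp_u assms) auto
qed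

text \<open>F' is bounded on the compact rectangle, and a constant is an integrable bound because
  the measure is finite.\<close>

lemma has_real_derivative_integral_comp_u:
  fixes F F' :: "real \<Rightarrow> real \<Rightarrow> real"
  assumes t: "\<bar>t0\<bar> < T"
    and F: "\<And>y t. y \<in> {- 1..1} \<Longrightarrow> \<bar>t\<bar> \<le> T \<Longrightarrow> (F y has_real_derivative F' y t) (at t)"
    and cF: "\<And>t. \<bar>t\<bar> \<le> T \<Longrightarrow> continuous_on {- 1..1} (\<lambda>y. F y t)"
    and cF': "continuous_on ({- 1..1} \<times> {- T..T}) (\<lambda>z. F' (fst z) (snd z))"
  shows "((\<lambda>t. \<integral>x. F (u x) t \<partial>M) has_real_derivative (\<integral>x. F' (u x) t0 \<partial>M)) (at t0)"
proof -
  have "bounded ((\<lambda>z. F' (fst z) (snd z)) ` ({- 1..1} \<times> {- T..T}))"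
    using cF' by (intro compact_imp_bounded compact_continuous_image compact_Times) auto
  then obtain B where B: "\<And>y t. y \<in> {- 1..1} \<Longrightarrow> t \<in> {- T..T} \<Longrightarrow> norm (F' y t) \<le> B"
    unfolding bounded_iff by force
  show ?thesis
  proof (rule has_real_derivative_integral[where \<delta>="T - \<bar>t0\<bar>" and w="\<lambda>_. B"])
    show "T - \<bar>t0\<bar> > 0" using t by simp
    show "integrable M (\<lambda>x. F (u x) t)" if "\<bar>t - t0\<bar> < T - \<bar>t0\<bar>" for t
      using that by (intro integrable_comp_u cF) auto
    have "continuous_on {- 1..1} (\<lambda>y. F' y t0)"
      by (rule continuous_on_compose2[OF cF', of _ "\<lambda>y. (y, t0)", simplified])
         (use t in \<open>auto intro!: continuous_intros\<close>)
    then show "(\<lambda>x. F' (u x) t0) \<in> borel_measurable M" by (rule measurable_comp_u)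
    show "integrable M (\<lambda>_. B)" by simp
    show "\<bar>F (u x) t - F (u x) t0\<bar> \<le> B * \<bar>t - t0\<bar>" if "\<bar>t - t0\<bar> < T - \<bar>t0\<bar>" for x t
    proof -
      have "norm (F (u x) t - F (u x) t0) \<le> B * norm (t - t0)"
      proof (rule field_differentiable_bound[of "{- T..T}"])
        show "(F (u x) has_field_derivative F' (u x) z) (at z within {- T..T})" if "z \<in> {- T..T}" for z
        proof -
          have "\<bar>z\<bar> \<le> T" using that by auto
          from F[OF u_bound this] show ?thesis by (rule has_field_derivative_at_within)
        qed
        show "norm (F' (u x) z) \<le> B" if "z \<in> {- T..T}" for z
          using B[OF u_bound that] .
      qed (use t that in auto)
      then show ?thesis by simp
    qed
    show "AE x in M. (F (u x) has_real_derivative F' (u x) t0) (at t0)"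
      using t by (intro AE_I2 F u_bound) simp
  qed
qed

section \<open>The integrals \<open>phi\<close>, their equations and their closed form\<close>

context
  fixes R :: real
  assumes R: "R > 0"
begin

text \<open>\<open>sqdist y t\<close> is the squared distance of \<open>t e\<close> to a point with coordinate \<open>R y\<close> along the unit
  vector \<open>e\<close> on the sphere of radius \<open>R\<close>.\<close>

definition sqdist :: "real \<Rightarrow> real \<Rightarrow> real" where
  "sqdist y t = R\<^sup>2 + t\<^sup>2 - 2 * R * t * y"

lemma sqdist_pos:
  assumes "y \<in> {- 1..1}" "\<bar>t\<bar> < R"
  shows "sqdist y t > 0"
proof -
  have "2 * R * t * y \<le> 2 * R * \<bar>t\<bar>"
  proof -
    have "\<bar>t\<bar> * \<bar>y\<bar> \<le> \<bar>t\<bar> * 1" using assms by (intro mult_left_mono) auto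
    then have "t * y \<le> \<bar>t\<bar>" using abs_ge_self[of "t * y"] by (simp add: abs_mult)
    then show ?thesis using R by (simp add: mult.assoc)
  qed
  moreover have "(R - \<bar>t\<bar>)\<^sup>2 > 0" using assms by simp
  ultimately show ?thesis by (simp add: sqdist_def power2_diff)
qed

lemma continuous_on_kap_sqdist:
  assumes "\<And>z. z \<in> S \<Longrightarrow> f z \<in> {- 1..1}" "\<And>z. z \<in> S \<Longrightarrow> \<bar>g z\<bar> < R"
    and "continuous_on S f" "continuous_on S g"
  shows "continuous_on S (\<lambda>z. kap i (sqdist (f z) (g z)))"
proof (rule continuous_on_compose2[OF continuous_on_kap])
  show "continuous_on S (\<lambda>z. sqdist (f z) (g z))"
    unfolding sqdist_def by (intro continuous_intros assms)
  show "(\<lambda>z. sqdist (f z) (g z)) ` S \<subseteq> {0<..}"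
    using assms(1,2) sqdist_pos by auto
qed

definition phi :: "nat \<Rightarrow> real \<Rightarrow> real" where
  "phi i t = (\<integral>x. kap i (sqdist (u x) t) \<partial>M)"

definition phi1 :: "nat \<Rightarrow> real \<Rightarrow> real" where
  "phi1 i t = (\<integral>x. - (kap (Suc i) (sqdist (u x) t) * (t - R * u x)) \<partial>M)"

definition phi2 :: "nat \<Rightarrow> real \<Rightarrow> real" where
  "phi2 i t = (\<integral>x. kap (Suc (Suc i)) (sqdist (u x) t) * (t - R * u x)\<^sup>2 - kap (Suc i) (sqdist (u x) t) \<partial>M)"

lemma kap_sqdist_deriv:
  assumes "y \<in> {- 1..1}" "\<bar>t\<bar> < R"
  shows "((\<lambda>t. kap i (sqdist y t)) has_real_derivative - (kap (Suc i) (sqdist y t) * (t - R * y))) (at t)"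
proof -
  have "((\<lambda>t. kap i (sqdist y t)) has_real_derivative - kap (Suc i) (sqdist y t) / 2 * (2 * t - 2 * R * y)) (at t)"
    by (rule DERIV_chain2[where f="kap i" and g="sqdist y" and x=t, OF kap_deriv[OF sqdist_pos[OF assms]]])
       (auto simp: sqdist_def[abs_def] intro!: derivative_eq_intros)
  then show ?thesis by (simp add: algebra_simps diff_divide_distrib)
qed

lemma phi_deriv:
  assumes t: "\<bar>t\<bar> < R"
  shows "(phi i has_real_derivative phi1 i t) (at t)"
    and "(phi1 i has_real_derivative phi2 i t) (at t)"
proof -
  \<comment> \<open>An intermediate T gives a compact rectangle on which \<open>sqdist\<close> stays
    positive.\<close>
  obtain T where T: "\<bar>t\<bar> < T" "T < R" using t dense by blast
  show "(phi i has_real_derivative phi1 i t) (at t)"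
    unfolding phi_def[abs_def] phi1_def
  proof (rule has_real_derivative_integral_comp_u[OF T(1)])
    show "((\<lambda>t. kap i (sqdist y t)) has_real_derivative - (kap (Suc i) (sqdist y t) * (t - R * y))) (at t)"
      if "y \<in> {- 1..1}" "\<bar>t\<bar> \<le> T" for y t
      using that T by (intro kap_sqdist_deriv) auto
  qed (intro continuous_intros continuous_on_kap_sqdist; use T in auto)+
  show "(phi1 i has_real_derivative phi2 i t) (at t)"
    unfolding phi1_def[abs_def] phi2_def
  proof (rule has_real_derivative_integral_comp_u[OF T(1)])
    show "((\<lambda>t. - (kap (Suc i) (sqdist y t) * (t - R * y))) has_real_derivative
        kap (Suc (Suc i)) (sqdist y t) * (t - R * y)\<^sup>2 - kap (Suc i) (sqdist y t)) (at t)"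
      if "y \<in> {- 1..1}" "\<bar>t\<bar> \<le> T" for y t
      using that T
      by (auto intro!: derivative_eq_intros kap_sqdist_deriv simp: algebra_simps power2_eq_square)
  qed (intro continuous_intros continuous_on_kap_sqdist; use T in auto)+
qed

text \<open>Integration by parts with G = \<open>kap (Suc i)\<close> of \<open>sqdist\<close> trades
  the mean of u G for one of (1 - u^2) \<open>kap (Suc (Suc i))\<close>. The splitting
  \<open>sqdist\<close> = (t - R u)^2 + R^2 (1 - u^2) and \<open>kap_rec\<close> remove the square
  from \<open>phi2\<close>. The two integrals with weight 1 - u^2 then cancel.\<close>

lemma phi_ode:
  assumes t: "0 < t" "t < R"
  shows "t * phi2 i t + 2 * real p * phi1 i t = t * (phi i t - 2 * (real p - real i) * phi (Suc i) t)"
proof -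
  let ?k = "\<lambda>i x. kap i (sqdist (u x) t)"
  have int: "integrable M (\<lambda>x. ?k i x)" "integrable M (\<lambda>x. u x * ?k i x)"
    "integrable M (\<lambda>x. ?k i x * (t - R * u x)\<^sup>2)" "integrable M (\<lambda>x. (1 - (u x)\<^sup>2) * ?k i x)" for i
    by (intro integrable_comp_u continuous_intros continuous_on_kap_sqdist; use t in auto)+
  have "(\<integral>x. (1 - (u x)\<^sup>2) * (R * t * ?k (Suc (Suc i)) x) \<partial>M) = 2 * real p * (\<integral>x. u x * ?k (Suc i) x \<partial>M)"
  proof (rule by_parts[of "\<lambda>y. kap (Suc i) (sqdist y t)" "\<lambda>y. R * t * kap (Suc (Suc i)) (sqdist y t)"])
    fix y :: real assume y: "y \<in> {- 1..1}"
    have "((\<lambda>y. kap (Suc i) (sqdist y t)) has_real_derivative - kap (Suc (Suc i)) (sqdist y t) / 2 * (- 2 * R * t)) (at y)"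
      by (rule DERIV_chain2[where f="kap (Suc i)" and g="\<lambda>y. sqdist y t" and x=y, OF kap_deriv[OF sqdist_pos[OF y]]])
         (use t in \<open>auto simp: sqdist_def intro!: derivative_eq_intros\<close>)
    then show "((\<lambda>y. kap (Suc i) (sqdist y t)) has_real_derivative R * t * kap (Suc (Suc i)) (sqdist y t)) (at y)"
      by (simp add: mult_ac)
  qed (intro continuous_intros continuous_on_kap_sqdist; use t in auto)
  then have stein: "R * t * (\<integral>x. (1 - (u x)\<^sup>2) * ?k (Suc (Suc i)) x \<partial>M) = 2 * real p * (\<integral>x. u x * ?k (Suc i) x \<partial>M)"
    by (simp add: mult.left_commute)
  have p1: "phi1 i t = R * (\<integral>x. u x * ?k (Suc i) x \<partial>M) - t * phi (Suc i) t"
  proof -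
    have "phi1 i t = (\<integral>x. R * (u x * ?k (Suc i) x) - t * ?k (Suc i) x \<partial>M)"
      unfolding phi1_def by (intro Bochner_Integration.integral_cong) (auto simp: algebra_simps)
    then show ?thesis using int by (simp add: phi_def)
  qed
  have "R\<^sup>2 * (\<integral>x. (1 - (u x)\<^sup>2) * ?k (Suc (Suc i)) x \<partial>M) + (\<integral>x. ?k (Suc (Suc i)) x * (t - R * u x)\<^sup>2 \<partial>M)
      = (\<integral>x. R\<^sup>2 * ((1 - (u x)\<^sup>2) * ?k (Suc (Suc i)) x) + ?k (Suc (Suc i)) x * (t - R * u x)\<^sup>2 \<partial>M)"
    using int by simp
  also have "\<dots> = (\<integral>x. ?k i x + real (2 * i + 1) * ?k (Suc i) x \<partial>M)"
  proof (intro Bochner_Integration.integral_cong refl)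
    fix x
    have "R\<^sup>2 * ((1 - (u x)\<^sup>2) * ?k (Suc (Suc i)) x) + ?k (Suc (Suc i)) x * (t - R * u x)\<^sup>2
        = sqdist (u x) t * ?k (Suc (Suc i)) x"
      by (simp add: sqdist_def algebra_simps power2_eq_square)
    also have "\<dots> = ?k i x + real (2 * i + 1) * ?k (Suc i) x"
      by (rule kap_rec) (use sqdist_pos u_bound t in auto)
    finally show "R\<^sup>2 * ((1 - (u x)\<^sup>2) * ?k (Suc (Suc i)) x) + ?k (Suc (Suc i)) x * (t - R * u x)\<^sup>2
        = ?k i x + real (2 * i + 1) * ?k (Suc i) x" .
  qed
  also have "\<dots> = phi i t + real (2 * i + 1) * phi (Suc i) t"
    using int by (simp add: phi_def)
  finally have rec: "(\<integral>x. ?k (Suc (Suc i)) x * (t - R * u x)\<^sup>2 \<partial>M)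
      = phi i t + real (2 * i + 1) * phi (Suc i) t - R\<^sup>2 * (\<integral>x. (1 - (u x)\<^sup>2) * ?k (Suc (Suc i)) x \<partial>M)"
    by simp
  have p2: "phi2 i t = (\<integral>x. ?k (Suc (Suc i)) x * (t - R * u x)\<^sup>2 \<partial>M) - phi (Suc i) t"
    unfolding phi2_def phi_def using int by simp
  define A where "A = (\<integral>x. (1 - (u x)\<^sup>2) * ?k (Suc (Suc i)) x \<partial>M)"
  define B where "B = (\<integral>x. u x * ?k (Suc i) x \<partial>M)"
  have "t * phi2 i t + 2 * real p * phi1 i t
      = t * (phi i t + real (2 * i) * phi (Suc i) t) - R * (R * t * A) + R * (2 * real p * B) - 2 * real p * t * phi (Suc i) t"
    unfolding p1 p2 rec A_def[symmetric] B_def[symmetric] by (simp add: algebra_simps power2_eq_square)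
  also have "R * t * A = 2 * real p * B" using stein by (simp add: A_def B_def)
  finally show ?thesis by (simp add: algebra_simps)
qed

lemma phi_0: "phi i 0 = chi i R * exp (- R) / R ^ (2 * i) * measure M (space M)"
  using R by (simp add: phi_def sqdist_def kap_def power_mult)

text \<open>At t = 0 the integrand is a constant multiple of u, which has mean 0. This is the
  initial slope required for uniqueness.\<close>

lemma phi1_0: "phi1 i 0 = 0"
  using integral_u by (simp add: phi1_def sqdist_def)

text \<open>The coefficients are forced by two requirements: \<open>psi j\<close> satisfies the equation of \<open>phi (p - j)\<close>
  with right-hand side \<open>psi (j - 1)\<close>, and has the same value at 0.\<close>

definition psi_coeff :: "nat \<Rightarrow> real" where
  "psi_coeff j = chi (p + j) R * exp (- R) / (R ^ (2 * p) * tau p 0) * measure M (space M)"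

definition psi :: "nat \<Rightarrow> real \<Rightarrow> real" where
  "psi j t = (\<Sum>m\<le>j. real (j choose m) * psi_coeff (j - m) * tau (p - m) t)"

definition psi1 :: "nat \<Rightarrow> real \<Rightarrow> real" where
  "psi1 j t = (\<Sum>m\<le>j. real (j choose m) * psi_coeff (j - m) * (- t * tau (Suc (p - m)) t))"

definition psi2 :: "nat \<Rightarrow> real \<Rightarrow> real" where
  "psi2 j t = (\<Sum>m\<le>j. real (j choose m) * psi_coeff (j - m) *
     (t\<^sup>2 * tau (Suc (Suc (p - m))) t - tau (Suc (p - m)) t))"

lemma psi1_0: "psi1 j 0 = 0"
  by (simp add: psi1_def)

lemma psi_deriv:
  "(psi j has_real_derivative psi1 j t) (at t)" "(psi1 j has_real_derivative psi2 j t) (at t)"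
proof -
  show "(psi j has_real_derivative psi1 j t) (at t)"
    unfolding psi_def[abs_def] psi1_def by (intro DERIV_sum DERIV_cmult tau_deriv)
  have "((\<lambda>t. - t * tau (Suc i) t) has_real_derivative t\<^sup>2 * tau (Suc (Suc i)) t - tau (Suc i) t) (at t)" for i
    by (rule derivative_eq_intros tau_deriv refl)+ (simp add: power2_eq_square)
  then show "(psi1 j has_real_derivative psi2 j t) (at t)"
    unfolding psi1_def[abs_def] psi2_def by (intro DERIV_sum DERIV_cmult)
qed

text \<open>By \<open>tau_rec\<close>, the term \<open>tau (p - m)\<close> produces the source -2 m
  \<open>tau (Suc (p - m))\<close>. The identity m (j choose m) = j (j - 1 choose m - 1) collects
  these sources into \<open>psi (j - 1)\<close>; for j = 0 they vanish.\<close>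

lemma psi_ode:
  assumes "j \<le> p"
  shows "t * psi2 j t + 2 * real p * psi1 j t = t * (psi j t - 2 * real j * psi (j - 1) t)"
proof -
  let ?a = "\<lambda>m. real (j choose m) * psi_coeff (j - m)"
  have "t * psi2 j t + 2 * real p * psi1 j t = (\<Sum>m\<le>j. t * (?a m * tau (p - m) t
      - 2 * (real m * ?a m * tau (Suc (p - m)) t)))"
    unfolding psi2_def psi1_def sum_distrib_left sum.distrib[symmetric]
  proof (intro sum.cong refl)
    fix m assume "m \<in> {..j}"
    then have "real (p - m) = real p - real m" using assms by auto
    then have r: "t\<^sup>2 * tau (Suc (Suc (p - m))) t = tau (p - m) t + (2 * (real p - real m) + 1) * tau (Suc (p - m)) t"
      using tau_rec[of t "p - m"] by simp
    show "t * (?a m * (t\<^sup>2 * tau (Suc (Suc (p - m))) t - tau (Suc (p - m)) t)) +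
        2 * real p * (?a m * (- t * tau (Suc (p - m)) t)) =
        t * (?a m * tau (p - m) t - 2 * (real m * ?a m * tau (Suc (p - m)) t))"
      unfolding r by (simp add: algebra_simps)
  qed
  also have "\<dots> = t * (psi j t - 2 * (\<Sum>m\<le>j. real m * ?a m * tau (Suc (p - m)) t))"
    by (simp add: psi_def sum_distrib_left sum_subtractf right_diff_distrib)
  also have "(\<Sum>m\<le>j. real m * ?a m * tau (Suc (p - m)) t) = real j * psi (j - 1) t"
  proof (cases j)
    case (Suc k)
    have "(\<Sum>m\<le>j. real m * ?a m * tau (Suc (p - m)) t)
        = (\<Sum>m\<le>k. real (Suc m * (Suc k choose Suc m)) * psi_coeff (k - m) * tau (Suc (p - Suc m)) t)"
      unfolding Suc by (subst sum.atMost_Suc_shift) (simp add: mult.assoc del: binomial_Suc_Suc of_nat_Suc mult_Suc)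
    also have "\<dots> = (\<Sum>m\<le>k. real (Suc k) * (real (k choose m) * psi_coeff (k - m) * tau (p - m) t))"
    proof (intro sum.cong refl)
      fix m assume "m \<in> {..k}"
      then have "Suc (p - Suc m) = p - m" using assms Suc by auto
      moreover have "real (Suc m * (Suc k choose Suc m)) = real (Suc k) * real (k choose m)"
        by (metis Suc_times_binomial_eq mult.commute of_nat_mult)
      ultimately show "real (Suc m * (Suc k choose Suc m)) * psi_coeff (k - m) * tau (Suc (p - Suc m)) t
          = real (Suc k) * (real (k choose m) * psi_coeff (k - m) * tau (p - m) t)"
        by (simp only: mult.assoc)
    qed
    finally show ?thesis by (simp add: psi_def Suc sum_distrib_left)
  qed simp
  finally show ?thesis by simp
qed

text \<open>Up to a constant the left side is the diagonal sum \<open>chitau R j (p + j) p\<close>;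
  the factor \<open>tau p 0\<close> from \<open>chitau_diag\<close> cancels the one in the
  denominator of \<open>psi_coeff\<close>.\<close>

lemma psi_0:
  assumes "j \<le> p"
  shows "psi j 0 = phi (p - j) 0"
proof -
  have t0: "tau p 0 \<noteq> 0" using tau_0_fact[of p] by auto
  have "psi j 0 = exp (- R) / (R ^ (2 * p) * tau p 0) * measure M (space M) * chitau R j (p + j) p"
    unfolding psi_def psi_coeff_def chitau_def sum_distrib_left
    by (intro sum.cong refl) (simp add: field_simps)
  also have "\<dots> = exp (- R) * (R ^ (2 * j) / R ^ (2 * p)) * chi (p - j) R * measure M (space M)"
    using t0 by (simp add: chitau_diag[OF assms])
  also have "R ^ (2 * j) / R ^ (2 * p) = 1 / R ^ (2 * (p - j))"
    using assms R by (simp add: right_diff_distrib' power_diff)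
  finally show ?thesis by (simp add: phi_0)
qed

lemma phi_eq_psi:
  assumes "j \<le> p" "0 \<le> t" "t < R"
  shows "phi (p - j) t = psi j t"
  using assms
proof (induction j arbitrary: t)
  case 0
  \<comment> \<open>For i = p the factor p - i in \<open>phi_ode\<close> vanishes, so the difference
    solves the homogeneous equation.\<close>
  have "phi p t - psi 0 t = 0"
  proof (rule radial_ode_unique[where w="\<lambda>t. phi p t - psi 0 t" and w'="\<lambda>t. phi1 p t - psi1 0 t"
        and w''="\<lambda>t. phi2 p t - psi2 0 t" and c="2 * real p" and a=R])
    fix t assume "0 < t" "t < R"
    then show "t * (phi2 p t - psi2 0 t) + 2 * real p * (phi1 p t - psi1 0 t) = t * (phi p t - psi 0 t)"
      using phi_ode[of t p] psi_ode[of 0 t] by (simp add: algebra_simps)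
  qed (use psi_0[of 0] phi1_0[of p] 0 in \<open>auto intro!: DERIV_diff phi_deriv psi_deriv simp: psi1_0\<close>)
  then show ?case by simp
next
  case (Suc j)
  define i where "i = p - Suc j"
  have i: "Suc i = p - j" "real p - real i = real (Suc j)" using Suc.prems by (auto simp: i_def)
  have "phi i t - psi (Suc j) t = 0"
  proof (rule radial_ode_unique[where w="\<lambda>t. phi i t - psi (Suc j) t" and w'="\<lambda>t. phi1 i t - psi1 (Suc j) t"
        and w''="\<lambda>t. phi2 i t - psi2 (Suc j) t" and c="2 * real p" and a=R])
    fix t assume t: "0 < t" "t < R"
    \<comment> \<open>The induction hypothesis makes the two source terms equal, so they cancel in
      the difference.\<close>
    then have "phi (Suc i) t = psi j t" using Suc i by simp
    then show "t * (phi2 i t - psi2 (Suc j) t) + 2 * real p * (phi1 i t - psi1 (Suc j) t) = t * (phi i t - psi (Suc j) t)"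
      using phi_ode[OF t, of i] psi_ode[of "Suc j" t] Suc.prems(1) unfolding i(2) by (simp add: algebra_simps)
  qed (use psi_0[of "Suc j"] phi1_0[of i] Suc.prems in \<open>auto intro!: DERIV_diff phi_deriv psi_deriv simp: psi1_0 i_def\<close>)
  then show ?case by (simp add: i_def)
qed

lemma integral_exp_sqdist:
  assumes "0 \<le> t" "t < R"
  shows "(\<integral>x. exp (- sqrt (R\<^sup>2 + t\<^sup>2 - 2 * R * t * u x)) \<partial>M)
    = measure M (space M) * fact (2 * p) / R ^ (2 * p) *
      ((- 1) ^ p * exp (- R) / (2 ^ p * fact p) * (\<Sum>i = 0..p. real (p choose i) * chi (p + i) R * tau i t))"
proof -
  have t0: "tau p 0 = (- 1) ^ p * 2 ^ p * fact p / fact (2 * p)"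
    using tau_0_fact[of p] by (simp add: field_simps)
  have "(\<integral>x. exp (- sqrt (R\<^sup>2 + t\<^sup>2 - 2 * R * t * u x)) \<partial>M) = phi 0 t"
    by (simp add: phi_def kap_def sqdist_def)
  also have "\<dots> = psi p t" using phi_eq_psi[of p t] assms by simp
  also have "\<dots> = (\<Sum>m\<le>p. real (p choose m) * psi_coeff m * tau m t)"
    unfolding psi_def
    \<comment> \<open>Reversing the order of summation turns \<open>psi_coeff (p - m)\<close> and
      \<open>tau (p - m)\<close> into \<open>psi_coeff m\<close> and \<open>tau m\<close>.\<close>
    by (rule sum.reindex_bij_witness[where i="\<lambda>m. p - m" and j="\<lambda>m. p - m"]) (auto simp: binomial_symmetric[symmetric])
  also have "\<dots> = measure M (space M) * exp (- R) / (R ^ (2 * p) * tau p 0) * (\<Sum>m = 0..p. real (p choose m) * chi (p + m) R * tau m t)"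
    unfolding psi_coeff_def sum_distrib_left atMost_atLeast0 by (intro sum.cong refl) (simp add: field_simps)
  also have "measure M (space M) * exp (- R) / (R ^ (2 * p) * tau p 0)
      = measure M (space M) * fact (2 * p) / R ^ (2 * p) * ((- 1) ^ p * exp (- R) / (2 ^ p * fact p))"
    unfolding t0 using R by (cases "even p") (simp_all add: field_simps)
  finally show ?thesis by (simp add: mult.assoc)
qed

end

end

section \<open>Linear coordinates on the sphere\<close>

lemma lborel_integral_translate:
  fixes f :: "'a::euclidean_space \<Rightarrow> real"
  assumes "f \<in> borel_measurable borel"
  shows "(\<integral>x. f (x + c) \<partial>lborel) = (\<integral>x. f x \<partial>lborel)"
proof -
  have "(\<integral>x. f x \<partial>lborel) = (\<integral>x. f x \<partial>distr lborel borel ((+) c))"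
    by (simp add: lborel_distr_plus)
  also have "\<dots> = (\<integral>x. f (c + x) \<partial>lborel)"
    using assms by (subst integral_distr) auto
  finally show ?thesis by (simp add: add.commute)
qed

lemma lborel_integral_scale:
  fixes f :: "'a::euclidean_space \<Rightarrow> real"
  assumes [measurable]: "f \<in> borel_measurable borel" and "c \<noteq> 0"
  shows "(\<integral>x. f x \<partial>lborel) = \<bar>c\<bar> ^ DIM('a) * (\<integral>x. f (c *\<^sub>R x) \<partial>lborel)"
proof -
  have "(\<integral>x. f x \<partial>lborel) = (\<integral>x. f x \<partial>density (distr lborel borel (\<lambda>x. 0 + c *\<^sub>R x)) (\<lambda>_. \<bar>c\<bar> ^ DIM('a)))"
    using lborel_affine[OF assms(2), of "0::'a"] by simp
  also have "\<dots> = (\<integral>x. \<bar>c\<bar> ^ DIM('a) * f (c *\<^sub>R x) \<partial>lborel)"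
    by (simp add: integral_density integral_distr)
  finally show ?thesis by simp
qed

text \<open>Layer cake: \<open>1 - norm x\<close> is the length of \<open>{norm x<..1}\<close>, and by homogeneity the integral of \<open>g\<close>
  over the ball of radius \<open>\<rho>\<close> is \<open>\<rho> ^ DIM('a)\<close> times its integral over the unit ball.\<close>

lemma integral_ball_homogeneous:
  fixes g :: "'a::euclidean_space \<Rightarrow> real"
  assumes [measurable]: "g \<in> borel_measurable borel"
    and bound: "\<And>x. \<bar>g x\<bar> \<le> B"
    and hom: "\<And>c x. c > 0 \<Longrightarrow> g (c *\<^sub>R x) = g x"
  shows "(\<integral>x. indicator (ball 0 1) x * (g x * (1 - norm x)) \<partial>lborel)
    = (\<integral>x. indicator (ball 0 1) x * g x \<partial>lborel) / (real DIM('a) + 1)"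
proof -
  let ?F = "\<lambda>x \<rho>. indicator {0<..1} \<rho> * (indicator {(x, \<rho>). norm x < \<rho>} (x, \<rho>) * g x)"
  have B: "B \<ge> 0" using bound[of 0] by simp
  have int: "integrable (lborel \<Otimes>\<^sub>M lborel) (case_prod ?F)"
  proof (rule integrableI_bounded_set[where A="ball 0 1 \<times> {0<..1}" and B=B])
    show "emeasure (lborel \<Otimes>\<^sub>M lborel) (ball (0::'a) 1 \<times> {0<..1::real}) < \<infinity>"
      by (subst lborel.emeasure_pair_measure_Times)
         (use emeasure_lborel_ball_finite[of "0::'a" 1] in \<open>auto simp: ennreal_mult_less_top less_top\<close>)
  qed (use bound B in \<open>auto simp: indicator_def abs_mult intro!: AE_I2\<close>)
  have inner1: "(\<integral>\<rho>. ?F x \<rho> \<partial>lborel) = indicator (ball 0 1) x * (g x * (1 - norm x))" for x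
  proof -
    have "(\<integral>\<rho>. ?F x \<rho> \<partial>lborel) = (\<integral>\<rho>. g x * indicator {norm x<..1} \<rho> \<partial>lborel)"
      by (intro Bochner_Integration.integral_cong) (auto simp: indicator_def dest: le_less_trans[OF norm_ge_zero])
    also have "\<dots> = g x * measure lborel {norm x<..1}" by simp
    also have "\<dots> = indicator (ball 0 1) x * (g x * (1 - norm x))"
      by (cases "norm x < 1") (auto simp: indicator_def)
    finally show ?thesis .
  qed
  define I where "I = (\<integral>x. indicator (ball 0 1) x * g x \<partial>lborel)"
  have inner2: "(\<integral>x. ?F x \<rho> \<partial>lborel) = indicator {0<..1} \<rho> * \<rho> ^ DIM('a) * I" for \<rho>
  proof (cases "\<rho> \<in> {0<..1}")
    case True
    then have \<rho>: "\<rho> > 0" by simp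
    have "(\<integral>x. ?F x \<rho> \<partial>lborel) = (\<integral>x. indicator (ball 0 \<rho>) x * g x \<partial>lborel)"
      using True by (intro Bochner_Integration.integral_cong) (auto simp: indicator_def)
    also have "\<dots> = \<rho> ^ DIM('a) * (\<integral>x. indicator (ball 0 \<rho>) (\<rho> *\<^sub>R x) * g (\<rho> *\<^sub>R x) \<partial>lborel)"
      using \<rho> by (subst lborel_integral_scale[of _ \<rho>]) (measurable, auto)
    also have "(\<integral>x. indicator (ball 0 \<rho>) (\<rho> *\<^sub>R x) * g (\<rho> *\<^sub>R x) \<partial>lborel) = I"
      unfolding I_def using \<rho> hom
      by (intro Bochner_Integration.integral_cong) (auto simp: indicator_def mult_less_cancel_left1)
    finally show ?thesis using True by simp
  qed simp
  have "(\<integral>x. indicator (ball 0 1) x * (g x * (1 - norm x)) \<partial>lborel)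
      = (\<integral>\<rho>. indicator {0<..1} \<rho> * \<rho> ^ DIM('a) * I \<partial>lborel)"
    using lborel_pair.Fubini_integral[OF int] unfolding inner1 inner2 by simp
  also have "\<dots> = I * (\<integral>\<rho>. indicator {0..1} \<rho> * \<rho> ^ DIM('a) \<partial>lborel)"
  proof -
    \<comment> \<open>The added endpoint 0 contributes nothing, since the exponent
      \<open>DIM('a)\<close> is positive.\<close>
    have "(\<integral>\<rho>. indicator {0<..1} \<rho> * \<rho> ^ DIM('a) * I \<partial>lborel) = (\<integral>\<rho>. I * (indicator {0..1} \<rho> * \<rho> ^ DIM('a)) \<partial>lborel)"
      by (intro Bochner_Integration.integral_cong) (auto simp: indicator_def)
    then show ?thesis by simp
  qed
  also have "(\<integral>\<rho>. indicator {0..1} \<rho> * \<rho> ^ DIM('a) \<partial>lborel) = 1 / (real DIM('a) + 1)"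
    using integral_power[of 0 1 "DIM('a)"] by (simp add: mult.commute add.commute)
  finally show ?thesis by (simp add: I_def)
qed

text \<open>The linear coordinate of x / |x|, extended with degree 0. Division by zero gives
  \<open>coord e 0 = 0\<close>, so the bounds below hold at the origin too.\<close>

definition coord :: "'a::euclidean_space \<Rightarrow> 'a \<Rightarrow> real" where
  "coord e x = inner x e / norm x"

lemma coord_measurable [measurable]: "coord e \<in> borel_measurable borel"
  unfolding coord_def[abs_def] by measurable

lemma norm_coord: "norm x * coord e x = inner x e"
  by (simp add: coord_def)

lemma coord_scaleR: "c > 0 \<Longrightarrow> coord e (c *\<^sub>R x) = coord e x"
  by (simp add: coord_def)

text \<open>The integrand is odd under x -> -x and the ball is symmetric.\<close>

lemma integral_coord: "(\<integral>x. indicator (ball 0 1) x * coord e x \<partial>lborel) = 0"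
proof -
  have "(\<integral>x. indicator (ball 0 1) x * coord e x \<partial>lborel)
      = (\<integral>x. indicator (ball 0 1) (- 1 *\<^sub>R x) * coord e (- 1 *\<^sub>R x) \<partial>lborel)"
    by (subst lborel_integral_scale[of _ "- 1"]) (measurable, auto)
  also have "\<dots> = (\<integral>x. - (indicator (ball 0 1) x * coord e x) \<partial>lborel)"
    by (intro Bochner_Integration.integral_cong) (auto simp: indicator_def coord_def)
  finally show ?thesis by simp
qed

context
  fixes e :: "'a::euclidean_space"
  assumes e: "norm e = 1"
begin

lemma coord_bound: "coord e x \<in> {- 1..1}"
proof -
  have "\<bar>inner x e\<bar> \<le> norm x" using Cauchy_Schwarz_ineq2[of x e] e by simp
  then have "\<bar>coord e x\<bar> \<le> 1" by (simp add: coord_def abs_divide divide_le_eq_1)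
  then show ?thesis by auto
qed

text \<open>\<open>coord e\<close> is not continuous at 0; the weight \<open>norm x\<close> tames it
  there.\<close>

lemma norm_coord_lipschitz: "norm x * \<bar>coord e x - coord e y\<bar> \<le> 2 * norm (x - y)"
proof -
  have "norm x * (coord e x - coord e y) = inner (x - y) e + (norm y - norm x) * coord e y"
    using norm_coord[of x] norm_coord[of y] by (simp add: algebra_simps inner_diff_left)
  moreover have "\<bar>inner (x - y) e\<bar> \<le> norm (x - y)" using Cauchy_Schwarz_ineq2[of "x - y" e] e by simp
  moreover have "\<bar>(norm y - norm x) * coord e y\<bar> \<le> norm (x - y) * 1"
    unfolding abs_mult using coord_bound[of y] norm_triangle_ineq3[of y x]
    by (intro mult_mono) (auto simp: norm_minus_commute)
  ultimately have "\<bar>norm x * (coord e x - coord e y)\<bar> \<le> 2 * norm (x - y)" by linarith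
  then show ?thesis by (simp add: abs_mult)
qed

lemma coord_line_deriv:
  assumes x: "x \<noteq> 0"
  shows "((\<lambda>t. norm (x + t *\<^sub>R e)) has_real_derivative coord e x) (at 0)"
    and "((\<lambda>t. coord e (x + t *\<^sub>R e)) has_real_derivative (1 - (coord e x)\<^sup>2) / norm x) (at 0)"
proof -
  have ee: "inner e e = 1" using e by (simp add: norm_eq_1)
  have n: "norm (x + t *\<^sub>R e) = sqrt ((norm x)\<^sup>2 + 2 * t * inner x e + t\<^sup>2)" for t
    by (simp add: norm_eq_sqrt_inner inner_add_left inner_add_right ee inner_commute power2_eq_square algebra_simps)
  show N: "((\<lambda>t. norm (x + t *\<^sub>R e)) has_real_derivative coord e x) (at 0)"
    unfolding n using x by (auto intro!: derivative_eq_intros simp: coord_def field_simps)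
  have "((\<lambda>t. inner (x + t *\<^sub>R e) e / norm (x + t *\<^sub>R e)) has_real_derivative
      (1 * norm x - inner x e * coord e x) / (norm x * norm x)) (at 0)"
    by (rule derivative_eq_intros N refl | simp add: inner_add_left ee x)+
  moreover have "(1 * norm x - inner x e * coord e x) / (norm x * norm x) = (1 - (coord e x)\<^sup>2) / norm x"
    using x by (simp add: coord_def field_simps power2_eq_square)
  ultimately show "((\<lambda>t. coord e (x + t *\<^sub>R e)) has_real_derivative (1 - (coord e x)\<^sup>2) / norm x) (at 0)"
    by (simp add: coord_def)
qed

end

section \<open>Integration by parts on the unit ball\<close>

lemma AE_lborel_not_in_sphere: "AE x in (lborel :: 'a::euclidean_space measure). norm x \<noteq> r"
proof -
  have "sphere (0::'a) r \<in> null_sets lborel"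
    using negligible_sphere[of "0::'a" r] by (auto simp: null_sets_completion_iff negligible_iff_null_sets)
  from AE_not_in[OF this] show ?thesis by (auto simp: dist_norm)
qed

text \<open>By translation invariance the derivative in the direction \<open>e\<close> of a Lipschitz function \<open>f\<close> with
  compact support has integral 0; here \<open>f x = norm x * G (coord e x) * max 0 (1 - norm x)\<close>.\<close>

lemma coord_by_parts:
  fixes e :: "'a::euclidean_space" and G G' :: "real \<Rightarrow> real"
  assumes e: "norm e = 1"
    and G: "\<And>y. y \<in> {- 1..1} \<Longrightarrow> (G has_real_derivative G' y) (at y)"
    and G': "continuous_on {- 1..1} G'"
  shows "(\<integral>x. indicator (ball 0 1) x * ((1 - (coord e x)\<^sup>2) * G' (coord e x)) \<partial>lborel)
    = (real DIM('a) - 1) * (\<integral>x. indicator (ball 0 1) x * (coord e x * G (coord e x)) \<partial>lborel)"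
proof -
  define c where "c = (coord e :: 'a \<Rightarrow> real)"
  have c: "c x \<in> {- 1..1}" for x unfolding c_def by (rule coord_bound[OF e])
  have cG: "continuous_on {- 1..1} G"
    using G DERIV_isCont by (intro continuous_at_imp_continuous_on) blast
  have meas: "(\<lambda>x. g (c x)) \<in> borel_measurable borel" if "continuous_on {- 1..1} g" for g :: "real \<Rightarrow> real"
  proof -
    have "(\<lambda>x. g (max (- 1) (min 1 (c x)))) \<in> borel_measurable borel"
    proof (rule measurable_compose[of c])
      show "c \<in> borel_measurable borel" unfolding c_def by (rule coord_measurable)
      show "(\<lambda>y. g (max (- 1) (min 1 y))) \<in> borel_measurable borel"
        by (intro borel_measurable_continuous_onI continuous_on_compose2[OF that]) (auto intro!: continuous_intros)
    qed
    then show ?thesis using c by (simp add: min.absorb2 max.absorb2)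
  qed
  have [measurable]: "(\<lambda>x. G (c x)) \<in> borel_measurable borel" "(\<lambda>x. G' (c x)) \<in> borel_measurable borel"
    "c \<in> borel_measurable borel"
    using meas[OF cG] meas[OF G'] coord_measurable by (auto simp: c_def)
  have "bounded (G ` {- 1..1})" "bounded (G' ` {- 1..1})"
    using cG G' by (auto intro!: compact_imp_bounded compact_continuous_image)
  then obtain K L where K: "\<And>y. y \<in> {- 1..1} \<Longrightarrow> norm (G y) \<le> K" and L: "\<And>y. y \<in> {- 1..1} \<Longrightarrow> norm (G' y) \<le> L"
    unfolding bounded_iff by blast
  have K0: "K \<ge> 0" and L0: "L \<ge> 0" using K[of 0] L[of 0] by auto
  have G_lip: "\<bar>G y - G z\<bar> \<le> L * \<bar>y - z\<bar>" if "y \<in> {- 1..1}" "z \<in> {- 1..1}" for y z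
    using field_differentiable_bound[of "{- 1..1}" G G' L y z] that G L
    by (simp add: has_field_derivative_at_within)
  \<comment> \<open>The factor \<open>norm x\<close> makes h Lipschitz across the origin and cancels
    the 1 / \<open>norm x\<close> in the derivative of \<open>coord\<close>.\<close>
  define h where "h = (\<lambda>x. norm x * G (c x))"
  define k where "k = (\<lambda>x::'a. max 0 (1 - norm x))"
  define f where "f = (\<lambda>x. h x * k x)"
  have h_lip: "\<bar>h x - h y\<bar> \<le> (2 * L + K) * norm (x - y)" for x y
  proof -
    have "h x - h y = norm x * (G (c x) - G (c y)) + (norm x - norm y) * G (c y)"
      by (simp add: h_def algebra_simps)
    moreover have "\<bar>norm x * (G (c x) - G (c y))\<bar> \<le> L * (2 * norm (x - y))"
    proof -
      have "norm x * \<bar>G (c x) - G (c y)\<bar> \<le> norm x * (L * \<bar>c x - c y\<bar>)"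
        by (intro mult_left_mono G_lip c) auto
      also have "\<dots> = L * (norm x * \<bar>c x - c y\<bar>)" by simp
      also have "\<dots> \<le> L * (2 * norm (x - y))"
        unfolding c_def by (intro mult_left_mono norm_coord_lipschitz e L0)
      finally show ?thesis by (simp add: abs_mult)
    qed
    moreover have "\<bar>(norm x - norm y) * G (c y)\<bar> \<le> norm (x - y) * K"
      unfolding abs_mult using K[OF c] by (intro mult_mono norm_triangle_ineq3) auto
    ultimately show ?thesis by (simp add: algebra_simps)
  qed
  \<comment> \<open>The radius 3 covers x + t e for x in the ball of radius 2 and |t| < 1; it adds 3
    K to the constant 2 L + K of h.\<close>
  have f_lip: "\<bar>f x - f y\<bar> \<le> (2 * L + 4 * K) * norm (x - y)" if "norm y \<le> 3" for x y
  proof -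
    have "f x - f y = (h x - h y) * k x + h y * (k x - k y)"
      by (simp add: f_def algebra_simps)
    moreover have "\<bar>(h x - h y) * k x\<bar> \<le> (2 * L + K) * norm (x - y) * 1"
      unfolding abs_mult by (intro mult_mono h_lip) (auto simp: k_def K0 L0)
    moreover have "\<bar>h y * (k x - k y)\<bar> \<le> (3 * K) * norm (x - y)"
      unfolding abs_mult
    proof (intro mult_mono)
      show "\<bar>h y\<bar> \<le> 3 * K"
        unfolding h_def abs_mult using that K[OF c] by (intro mult_mono) auto
      have "\<bar>k x - k y\<bar> \<le> \<bar>norm x - norm y\<bar>" by (auto simp: k_def)
      then show "\<bar>k x - k y\<bar> \<le> norm (x - y)" using norm_triangle_ineq3[of x y] by simp
    qed (use K0 in auto)
    ultimately show ?thesis by (simp add: algebra_simps)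
  qed
  have [measurable]: "f \<in> borel_measurable borel"
    unfolding f_def h_def k_def by measurable
  define B where "B = 2 * L + 4 * K"
  \<comment> \<open>The derivative of f along e inside the ball, by \<open>coord_line_deriv\<close>;
    outside it is 0.\<close>
  define f' where "f' = (\<lambda>x. indicator (ball 0 1) x *
    ((1 - (c x)\<^sup>2) * G' (c x) * (1 - norm x) + c x * G (c x) * (1 - 2 * norm x)))"
  have f0: "f x = 0" if "norm x \<ge> 1" for x
    using that by (simp add: f_def k_def)
  have int_f: "integrable lborel f"
  proof (rule integrableI_bounded_set[where A="ball 0 1" and B="K"])
    show "AE x\<in>ball 0 1 in lborel. norm (f x) \<le> K"
    proof (intro AE_I2 impI)
      fix x :: 'a assume x: "x \<in> ball 0 1"
      have "norm x * \<bar>G (c x)\<bar> * \<bar>k x\<bar> \<le> 1 * K * 1"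
        using x K[OF c] K0 by (intro mult_mono) (auto simp: k_def)
      then show "norm (f x) \<le> K" by (simp add: f_def h_def abs_mult)
    qed
    show "AE x in lborel. x \<notin> ball 0 1 \<longrightarrow> f x = 0" using f0 by auto
  qed (use emeasure_lborel_ball_finite[of "0::'a" 1] in \<open>auto simp: less_top\<close>)
  have "((\<lambda>t. \<integral>x. f (x + t *\<^sub>R e) \<partial>lborel) has_real_derivative (\<integral>x. f' x \<partial>lborel)) (at 0)"
  proof (rule has_real_derivative_integral[where \<delta>=1 and w="\<lambda>x. B * indicator (ball 0 2) x"])
    show "integrable lborel (\<lambda>x. f (x + t *\<^sub>R e))" for t
    proof -
      have "integrable (distr lborel borel ((+) (t *\<^sub>R e))) f"
        using int_f by (simp add: lborel_distr_plus)
      then show ?thesis by (subst (asm) integrable_distr_eq) (auto simp: add.commute)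
    qed
    have "f' \<in> borel_measurable borel"
      unfolding f'_def by (rule borel_measurable_times, rule borel_measurable_indicator, simp, measurable)
    then show "f' \<in> borel_measurable lborel" by simp
    show "integrable lborel (\<lambda>x. B * indicator (ball (0::'a) 2) x)"
      using emeasure_lborel_ball_finite[of "0::'a" 2]
      by (intro integrable_mult_right integrable_real_indicator) (auto simp: less_top)
    show "\<bar>f (x + t *\<^sub>R e) - f (x + 0 *\<^sub>R e)\<bar> \<le> B * indicator (ball 0 2) x * \<bar>t - 0\<bar>"
      if "\<bar>t - 0\<bar> < 1" for x t
    proof (cases "norm x < 2")
      case True
      then show ?thesis using f_lip[of x "x + t *\<^sub>R e"] e by (simp add: B_def)
    next
      \<comment> \<open>The shift is shorter than 1, so both points lie outside the open unit ball,
        where f vanishes.\<close>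
      case False
      moreover have "norm (x + t *\<^sub>R e) \<ge> 1"
        using norm_diff_ineq[of x "t *\<^sub>R e"] False that e by simp
      ultimately show ?thesis using f0 by simp
    qed
    \<comment> \<open>The exceptional points, the origin and the unit sphere, form a null
      set.\<close>
    show "AE x in lborel. ((\<lambda>t. f (x + t *\<^sub>R e)) has_real_derivative f' x) (at 0)"
      using AE_lborel_singleton[of 0] AE_lborel_not_in_sphere[of 1]
    proof eventually_elim
      fix x :: 'a assume x: "x \<noteq> 0" "norm x \<noteq> 1"
      have "isCont (\<lambda>t. norm (x + t *\<^sub>R e)) 0" by (intro continuous_intros)
      then have cont: "((\<lambda>t. norm (x + t *\<^sub>R e)) \<longlongrightarrow> norm x) (nhds 0)"
        using tendsto_at_iff_tendsto_nhds[of "\<lambda>t. norm (x + t *\<^sub>R e)" 0] by (simp add: isCont_def)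
      show "((\<lambda>t. f (x + t *\<^sub>R e)) has_real_derivative f' x) (at 0)"
      proof (cases "norm x < 1")
        case True
        note d = coord_line_deriv[OF e x(1), folded c_def]
        have dG: "((\<lambda>t. G (c (x + t *\<^sub>R e))) has_real_derivative G' (c x) * ((1 - (c x)\<^sup>2) / norm x)) (at 0)"
          by (rule DERIV_chain2[where f=G and g="\<lambda>t. c (x + t *\<^sub>R e)" and x=0, OF _ d(2)]) (use G c in simp)
        have "((\<lambda>t. norm (x + t *\<^sub>R e) * G (c (x + t *\<^sub>R e)) * (1 - norm (x + t *\<^sub>R e))) has_real_derivative f' x) (at 0)"
          by (rule derivative_eq_intros d(1) dG refl)+ (use x True in \<open>simp add: f'_def field_simps\<close>)
        moreover have "eventually (\<lambda>t. norm (x + t *\<^sub>R e) < 1) (nhds 0)"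
          using order_tendstoD(2)[OF cont True] .
        then have "eventually (\<lambda>t. norm (x + t *\<^sub>R e) * G (c (x + t *\<^sub>R e)) * (1 - norm (x + t *\<^sub>R e)) = f (x + t *\<^sub>R e)) (nhds 0)"
          by eventually_elim (simp add: f_def h_def k_def)
        ultimately show ?thesis by (subst (asm) DERIV_cong_ev[OF refl _ refl]) auto
      next
        case False
        with x have "norm x > 1" by simp
        then have "eventually (\<lambda>t. norm (x + t *\<^sub>R e) > 1) (nhds 0)"
          by (rule order_tendstoD(1)[OF cont])
        then have "eventually (\<lambda>t. 0 = f (x + t *\<^sub>R e)) (nhds 0)"
          by eventually_elim (simp add: f0)
        moreover have "((\<lambda>t. 0) has_real_derivative f' x) (at 0)" using False by (simp add: f'_def)
        ultimately show ?thesis by (subst (asm) DERIV_cong_ev[OF refl _ refl]) auto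
      qed
    qed
  qed simp
  moreover have "(\<lambda>t. \<integral>x. f (x + t *\<^sub>R e) \<partial>lborel) = (\<lambda>t. \<integral>x. f x \<partial>lborel)"
    by (simp add: lborel_integral_translate)
  ultimately have f'_0: "(\<integral>x. f' x \<partial>lborel) = 0"
    using DERIV_unique[OF _ DERIV_const] by metis
  define p where "p = (\<lambda>x. (1 - (c x)\<^sup>2) * G' (c x))"
  define q where "q = (\<lambda>x. c x * G (c x))"
  have [measurable]: "p \<in> borel_measurable borel" "q \<in> borel_measurable borel"
    unfolding p_def q_def by measurable
  have c1: "\<bar>c x\<bar> \<le> 1" for x using c[of x] by auto
  have pb: "\<bar>p x\<bar> \<le> 1 * L" for x
  proof -
    have "(c x)\<^sup>2 \<le> 1" using c1[of x] by (simp add: abs_square_le_1)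
    then show ?thesis unfolding p_def abs_mult using L[OF c] by (intro mult_mono) auto
  qed
  have qb: "\<bar>q x\<bar> \<le> 1 * K" for x
    unfolding q_def abs_mult using c1 K[OF c] by (intro mult_mono) auto
  have hom: "c (a *\<^sub>R x) = c x" if "a > 0" for a x unfolding c_def using that by (rule coord_scaleR)
  have int: "integrable lborel (\<lambda>x. indicator (ball 0 1) x * (g x * r x))"
    if [measurable]: "g \<in> borel_measurable borel" "r \<in> borel_measurable borel" and g: "\<And>x. \<bar>g x\<bar> \<le> C"
      and r: "\<And>x. norm x < 1 \<Longrightarrow> \<bar>r x\<bar> \<le> 1" for g r :: "'a \<Rightarrow> real" and C
  proof (rule integrableI_bounded_set[where A="ball 0 1" and B="C * 1"])
    have "(\<lambda>x. indicator (ball 0 1) x * (g x * r x)) \<in> borel_measurable borel"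
      by (rule borel_measurable_times, rule borel_measurable_indicator, simp, measurable)
    then show "(\<lambda>x. indicator (ball 0 1) x * (g x * r x)) \<in> borel_measurable lborel" by simp
    have "C \<ge> 0" using g[of 0] by simp
    then show "AE x\<in>ball 0 1 in lborel. norm (indicator (ball 0 1) x * (g x * r x)) \<le> C * 1"
      using g r by (auto intro!: AE_I2 simp: abs_mult simp del: mult_1_right intro: mult_mono)
  qed (use emeasure_lborel_ball_finite[of "0::'a" 1] in \<open>auto simp: less_top\<close>)
  let ?I = "\<lambda>g. \<integral>x. indicator (ball 0 1) x * g x \<partial>lborel"
  \<comment> \<open>Writing 1 - 2 |x| as 2 (1 - |x|) - 1 leaves only the weights 1 - |x|, covered by
    \<open>integral_ball_homogeneous\<close>, and 1.\<close>
  have "0 = (\<integral>x. indicator (ball 0 1) x * (p x * (1 - norm x)) +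
      2 * (indicator (ball 0 1) x * (q x * (1 - norm x))) - indicator (ball 0 1) x * (q x * 1) \<partial>lborel)"
    unfolding f'_0[symmetric] f'_def p_def q_def
    by (intro Bochner_Integration.integral_cong) (auto simp: algebra_simps)
  also have "\<dots> = ?I (\<lambda>x. p x * (1 - norm x)) + 2 * ?I (\<lambda>x. q x * (1 - norm x)) - ?I (\<lambda>x. q x * 1)"
    by (subst Bochner_Integration.integral_diff Bochner_Integration.integral_add;
        (intro Bochner_Integration.integrable_add integrable_mult_right int[OF _ _ pb] int[OF _ _ qb])?; simp?)+
  also have "?I (\<lambda>x. p x * (1 - norm x)) = ?I p / (real DIM('a) + 1)"
    by (rule integral_ball_homogeneous[OF _ pb]) (auto simp: p_def hom)
  also have "?I (\<lambda>x. q x * (1 - norm x)) = ?I q / (real DIM('a) + 1)"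
    by (rule integral_ball_homogeneous[OF _ qb]) (auto simp: q_def hom)
  finally have "(?I p + 2 * ?I q) / (real DIM('a) + 1) = ?I q"
    by (simp add: add_divide_distrib)
  then have "?I p + 2 * ?I q = ?I q * (real DIM('a) + 1)"
    by (subst (asm) divide_eq_eq) (auto split: if_splits)
  then have "?I p = (real DIM('a) - 1) * ?I q"
    by (simp add: algebra_simps)
  then show ?thesis by (simp add: p_def q_def c_def)
qed

text \<open>The ball can replace the sphere because \<open>coord e\<close> is constant along rays;
  the factor \<open>DIM('a) - 1\<close> in \<open>coord_by_parts\<close> is 2 p.\<close>

lemma sphere_coordinate_coord:
  fixes e :: "'a::euclidean_space"
  assumes e: "norm e = 1" and dim: "DIM('a) = 2 * p + 1"
  shows "sphere_coordinate (restrict_space lborel (ball 0 1)) (coord e) p"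
proof -
  have int: "(\<integral>x. g x \<partial>restrict_space lborel (ball 0 1)) = (\<integral>x. indicator (ball 0 1) x * g x \<partial>lborel)"
    for g :: "'a \<Rightarrow> real"
    by (subst integral_restrict_space) auto
  interpret finite_measure "restrict_space lborel (ball (0::'a) 1)"
    using emeasure_lborel_ball_finite[of "0::'a" 1]
    by (intro finite_measureI) (simp add: emeasure_restrict_space less_top space_restrict_space)
  show ?thesis
  proof unfold_locales
    show "coord e \<in> borel_measurable (restrict_space lborel (ball 0 1))"
      using coord_measurable by (intro measurable_restrict_space1) simp
    show "coord e x \<in> {- 1..1}" for x by (rule coord_bound[OF e])
    show "(\<integral>x. coord e x \<partial>restrict_space lborel (ball 0 1)) = 0"
      unfolding int by (rule integral_coord)
    show "(\<integral>x. (1 - (coord e x)\<^sup>2) * G' (coord e x) \<partial>restrict_space lborel (ball 0 1))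
        = 2 * real p * (\<integral>x. coord e x * G (coord e x) \<partial>restrict_space lborel (ball 0 1))"
      if "\<And>y. y \<in> {- 1..1} \<Longrightarrow> (G has_real_derivative G' y) (at y)" "continuous_on {- 1..1} G'" for G G'
      unfolding int using coord_by_parts[OF e that] dim by simp
  qed
qed

section \<open>Surface integrals and the final formula\<close>

lemma integral_sphere_measure:
  fixes f :: "'a::euclidean_space \<Rightarrow> real"
  assumes [measurable]: "f \<in> borel_measurable borel" and R: "R > 0"
  shows "integral\<^sup>L (sphere_measure R) f = real DIM('a) * R ^ (DIM('a) - 1) *
    (\<integral>x. f ((R / norm x) *\<^sub>R x) \<partial>restrict_space lborel (ball 0 1))"
proof -
  let ?c = "real DIM('a) * R ^ (DIM('a) - 1)"
  let ?D = "distr (restrict_space lborel (ball (0::'a) 1)) borel (\<lambda>x. (R / norm x) *\<^sub>R x)"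
  have "(\<lambda>x::'a. (R / norm x) *\<^sub>R x) \<in> borel_measurable borel" by measurable
  then have m: "(\<lambda>x::'a. (R / norm x) *\<^sub>R x) \<in> measurable (restrict_space lborel (ball 0 1)) borel"
    by (intro measurable_restrict_space1) simp
  have c: "?c \<ge> 0" using R by simp
  \<comment> \<open>A constant density in place of the scaling makes \<open>integral_density\<close>
    applicable.\<close>
  have "sphere_measure R = density ?D (\<lambda>_. ennreal ?c)"
    by (rule measure_eqI) (auto simp: sphere_measure_def emeasure_density_const)
  then have "integral\<^sup>L (sphere_measure R) f = (\<integral>x. ?c * f x \<partial>?D)"
    using c by (simp add: integral_density)
  also have "\<dots> = ?c * (\<integral>x. f x \<partial>?D)" by simp
  also have "(\<integral>x. f x \<partial>?D) = (\<integral>x. f ((R / norm x) *\<^sub>R x) \<partial>restrict_space lborel (ball 0 1))"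
    by (rule integral_distr[OF m]) simp
  finally show ?thesis .
qed

theorem theorem1p3:
  fixes p :: nat and R :: real and s :: "real ^ 'n"
  assumes "CARD('n) = 2 * p + 1"
    and "R > 0"
    and "norm s < R"
  shows "(1 / (fact (CARD('n)) * unit_ball_volume TYPE(real ^ 'n))) *
           integral\<^sup>L (sphere_measure R) (\<lambda>x::real ^ 'n. exp (- norm (x - s)))
         = ((-1) ^ p * exp (- R) / (2 ^ p * fact p)) *
           (\<Sum>i = 0..p. real (p choose i) * chi (p + i) R * tau i (norm s))"
proof -
  \<comment> \<open>For s = 0 any unit vector serves.\<close>
  obtain e :: "real ^ 'n" where e: "norm e = 1" and s: "s = norm s *\<^sub>R e"
  proof (cases "s = 0")
    case True
    then show ?thesis using that[of "axis undefined 1"] by (simp add: norm_axis_1)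
  next
    case False
    then show ?thesis using that[of "(1 / norm s) *\<^sub>R s"] by simp
  qed
  let ?M = "restrict_space lborel (ball (0::real ^ 'n) 1)"
  have dim: "DIM(real ^ 'n) = 2 * p + 1" using assms(1) by simp
  interpret sphere_coordinate ?M "coord e" p by (rule sphere_coordinate_coord[OF e dim])
  have V: "measure ?M (space ?M) = unit_ball_volume TYPE(real ^ 'n)"
    by (simp add: unit_ball_volume_def space_restrict_space measure_restrict_space)
  have V0: "unit_ball_volume TYPE(real ^ 'n) > 0"
    unfolding unit_ball_volume_def by (simp add: content_ball)
  \<comment> \<open>The dimension 2p + 1 from the cone construction completes (2p)! to (2p + 1)!,
    and the powers of R cancel.\<close>
  have cancel: "real (2 * p + 1) * R ^ (2 * p) * (V * fact (2 * p) / R ^ (2 * p) * X) = fact (2 * p + 1) * V * X"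
    for V X :: real
    using assms(2) by simp
  have "integral\<^sup>L (sphere_measure R) (\<lambda>x::real ^ 'n. exp (- norm (x - s)))
      = real (2 * p + 1) * R ^ (2 * p) * (\<integral>x. exp (- norm ((R / norm x) *\<^sub>R x - s)) \<partial>?M)"
    using assms by (subst integral_sphere_measure) simp_all
  also have "(\<integral>x. exp (- norm ((R / norm x) *\<^sub>R x - s)) \<partial>?M)
      = (\<integral>x. exp (- sqrt (R\<^sup>2 + (norm s)\<^sup>2 - 2 * R * norm s * coord e x)) \<partial>?M)"
  \<comment> \<open>Off the origin this is the law of cosines; at the origin the radial projection
    yields 0 instead of a point of the sphere.\<close>
  proof (rule integral_cong_AE)
    have "AE x in ?M. x \<noteq> 0"
      by (subst AE_restrict_space_iff) (use AE_lborel_singleton[of 0] in auto)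
    then show "AE x in ?M. exp (- norm ((R / norm x) *\<^sub>R x - s))
        = exp (- sqrt (R\<^sup>2 + (norm s)\<^sup>2 - 2 * R * norm s * coord e x))"
    proof eventually_elim
      fix x :: "real ^ 'n" assume x: "x \<noteq> 0"
      have "inner x s = norm s * inner x e" by (subst s) simp
      moreover have "norm ((R / norm x) *\<^sub>R x) = R" using x assms(2) by simp
      moreover have "(norm (y - s))\<^sup>2 = (norm y)\<^sup>2 + (norm s)\<^sup>2 - 2 * inner y s" for y
        by (simp add: power2_norm_eq_inner inner_diff_left inner_diff_right inner_commute)
      ultimately have "(norm ((R / norm x) *\<^sub>R x - s))\<^sup>2 = R\<^sup>2 + (norm s)\<^sup>2 - 2 * R * norm s * coord e x"
        by (simp add: coord_def)
      then show "exp (- norm ((R / norm x) *\<^sub>R x - s))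
          = exp (- sqrt (R\<^sup>2 + (norm s)\<^sup>2 - 2 * R * norm s * coord e x))"
        by (metis norm_ge_zero real_sqrt_unique)
    qed
    show "(\<lambda>x. exp (- norm ((R / norm x) *\<^sub>R x - s))) \<in> borel_measurable ?M"
      by (intro measurable_restrict_space1) measurable
    show "(\<lambda>x. exp (- sqrt (R\<^sup>2 + (norm s)\<^sup>2 - 2 * R * norm s * coord e x))) \<in> borel_measurable ?M"
      by measurable
  qed
  also have "\<dots> = unit_ball_volume TYPE(real ^ 'n) * fact (2 * p) / R ^ (2 * p) *
      ((- 1) ^ p * exp (- R) / (2 ^ p * fact p) * (\<Sum>i = 0..p. real (p choose i) * chi (p + i) R * tau i (norm s)))"
    using integral_exp_sqdist[OF assms(2) norm_ge_zero assms(3)] unfolding V .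
  finally have I: "integral\<^sup>L (sphere_measure R) (\<lambda>x::real ^ 'n. exp (- norm (x - s)))
      = fact (2 * p + 1) * unit_ball_volume TYPE(real ^ 'n) *
      ((- 1) ^ p * exp (- R) / (2 ^ p * fact p) * (\<Sum>i = 0..p. real (p choose i) * chi (p + i) R * tau i (norm s)))"
    unfolding cancel .
  show ?thesis
    unfolding I assms(1) using V0 by simp
qed

end
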